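(* Let $G=(\mathcal{V},\mathcal{E})$ be a finite connected graph with at least two vertices, and let $\mathcal{P}=(\mathcal{P}_{\{v,w\}})_{\{v,w\}\in\mathcal{E}}$ be a probability measure on $\mathcal{E}$ with $\mathcal{P}_{\{v,w\}}>0$ for all edges. Let $x_0=(x_0(v))_{v\in\mathcal{V}}\in\mathbb{R}^{\mathcal{V}}$ and $\bar x=\frac1{|\mathcal{V}|}\sum_{v\in\mathcal{V}}x_0(v)$. Let $(x_t(v),z_t(v))_{v\in\mathcal{V},t\ge0}$ be generated by accelerated randomized gossip (defined in the context) with initialization $z_0=x_0$. Then for all $t\ge0$, $$\sum_{v\in\mathcal{V}}\frac12\mathbb{E}\big[(x_t(v)-\bar x)^2\big]\le2\Big(\sum_{v\in\mathcal{V}}\frac12(x_0(v)-\bar x)^2\Big)\exp\Big(-\sqrt{\frac{\mu_{\rm gossip}}{2R_{\max}}}\,t\Big).$$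
   Context: Graph quantities. The Laplacian $\mathcal{L}\in\mathbb{R}^{\mathcal{V}\times\mathcal{V}}$ with edge weights $\mathcal{P}$ has entries $\mathcal{L}_{v,w}=-\mathcal{P}_{\{v,w\}}$ if $\{v,w\}\in\mathcal{E}$, $\mathcal{L}_{v,v}=\sum_{w:\{v,w\}\in\mathcal{E}}\mathcal{P}_{\{v,w\}}$, and $0$ otherwise. $\mu_{\rm gossip}>0$ is its second smallest eigenvalue (its smallest positive eigenvalue). For $\{v,w\}\in\mathcal{E}$, the effective resistance is $R_{\rm eff}(v,w)=(e_v-e_w)^\top\mathcal{L}^{-1}(e_v-e_w)$, where $(e_v)$ is the canonical basis of $\mathbb{R}^{\mathcal{V}}$ and $\mathcal{L}^{-1}$ denotes the pseudo-inverse; $R_{\max}=\max_{\{v,w\}\in\mathcal{E}}R_{\rm eff}(v,w)$. Communication model. $\mathrm{d}N(t,e)=\sum_{k\ge1}\delta_{(T_k,\{v_k,w_k\})}$ is a Poisson point measure on $\mathbb{R}_{\ge0}\times\mathcal{E}$ with intensity $\mathrm{d}t\otimes\mathcal{P}$; that is, $T_1,T_2-T_1,\dots$ are i.i.d. exponential of rate $1$ and the edges $\{v_k,w_k\}$ are i.i.d. of law $\mathcal{P}$, independent of the times. Accelerated randomized gossip. The processes are càdlàg ($x_{t-},z_{t-}$ denote left limits). At each time $T_k$, $$x_{T_k}(v_k)=x_{T_k}(w_k)=\frac{x_{T_k-}(v_k)+x_{T_k-}(w_k)}2,$$ $$z_{T_k}(v_k)=z_{T_k-}(v_k)+\frac{1}{\sqrt{2\mu_{\rm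 gossip}R_{\max}}}\big(x_{T_k-}(w_k)-x_{T_k-}(v_k)\big),$$ $$z_{T_k}(w_k)=z_{T_k-}(w_k)+\frac{1}{\sqrt{2\mu_{\rm gossip}R_{\max}}}\big(x_{T_k-}(v_k)-x_{T_k-}(w_k)\big),$$ all other coordinates being unchanged. Between these times, at every node $v$, $$\mathrm{d}x_t(v)=\sqrt{\tfrac{\mu_{\rm gossip}}{2R_{\max}}}\,(z_t(v)-x_t(v))\,\mathrm{d}t,\qquad \mathrm{d}z_t(v)=\sqrt{\tfrac{\mu_{\rm gossip}}{2R_{\max}}}\,(x_t(v)-z_t(v))\,\mathrm{d}t.$$ *)

theory Defs
  imports "HOL-Probability.Probability"
begin

(* The vertex set is the whole finite type 'v; an edge is a two-element set of vertices. *)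

definition connected_simple_graph :: "'v set set \<Rightarrow> bool" where
  "connected_simple_graph E \<longleftrightarrow>
     (\<forall>e\<in>E. card e = 2) \<and> (\<forall>v w. (v, w) \<in> {(a, b). {a, b} \<in> E}\<^sup>*)"

definition laplacian :: "'v::finite set set \<Rightarrow> 'v set pmf \<Rightarrow> real^'v^'v" where
  "laplacian E P = (\<chi> v w.
     if v = w then (\<Sum>u\<in>{u. {v, u} \<in> E}. pmf P {v, u})
     else if {v, w} \<in> E then - pmf P {v, w}
     else 0)"

definition is_eigenvalue :: "real^'n^'n \<Rightarrow> real \<Rightarrow> bool" where
  "is_eigenvalue A \<mu> \<longleftrightarrow> (\<exists>u. u \<noteq> 0 \<and> A *v u = \<mu> *\<^sub>R u)"

(* On a connected graph the eigenvalue 0 of the Laplacian is simple, so that the smallest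
   positive eigenvalue is the second smallest one, counted with multiplicity. *)
definition gossip_gap :: "'v::finite set set \<Rightarrow> 'v set pmf \<Rightarrow> real" where
  "gossip_gap E P = (LEAST \<mu>. 0 < \<mu> \<and> is_eigenvalue (laplacian E P) \<mu>)"

(* The four Penrose equations; they have exactly one solution for every real matrix. *)
definition is_pseudo_inverse :: "real^'n^'m \<Rightarrow> real^'m^'n \<Rightarrow> bool" where
  "is_pseudo_inverse A B \<longleftrightarrow>
     A ** B ** A = A \<and> B ** A ** B = B \<and>
     transpose (A ** B) = A ** B \<and> transpose (B ** A) = B ** A"

definition pseudo_inverse :: "real^'n^'m \<Rightarrow> real^'m^'n" where
  "pseudo_inverse A = (THE B. is_pseudo_inverse A B)"

definition effective_resistance :: "'v::finite set set \<Rightarrow> 'v set pmf \<Rightarrow> 'v \<Rightarrow> 'v \<Rightarrow> real" where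
  "effective_resistance E P v w =
     (axis v 1 - axis w 1) \<bullet> (pseudo_inverse (laplacian E P) *v (axis v 1 - axis w 1))"

definition max_resistance :: "'v::finite set set \<Rightarrow> 'v set pmf \<Rightarrow> real" where
  "max_resistance E P = Max {effective_resistance E P v w | v w. {v, w} \<in> E}"

(* Points (T k, e k) of a Poisson point measure with intensity dt x P, enumerated from k = 0
   in increasing order of time: i.i.d. rate-1 exponential waiting times, i.i.d. edges of law P,
   and independence of the sigma-algebras generated by the two sequences. (indep_var would force
   both sequences to have the same type.) *)

definition waiting_time :: "(nat \<Rightarrow> 'o \<Rightarrow> real) \<Rightarrow> nat \<Rightarrow> 'o \<Rightarrow> real" where
  "waiting_time T k \<omega> = (case k of 0 \<Rightarrow> T 0 \<omega> | Suc j \<Rightarrow> T (Suc j) \<omega> - T j \<omega>)"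

definition poisson_edge_activations ::
  "'o measure \<Rightarrow> 'v set pmf \<Rightarrow> (nat \<Rightarrow> 'o \<Rightarrow> real) \<Rightarrow> (nat \<Rightarrow> 'o \<Rightarrow> 'v set) \<Rightarrow> bool" where
  "poisson_edge_activations M P T e \<longleftrightarrow>
     (\<forall>k. distributed M lborel (waiting_time T k) (exponential_density 1)) \<and>
     (\<forall>k. distr M (count_space UNIV) (e k) = measure_pmf P) \<and>
     prob_space.indep_vars M (\<lambda>_. borel) (waiting_time T) UNIV \<and>
     prob_space.indep_vars M (\<lambda>_. count_space UNIV) e UNIV \<and>
     prob_space.indep_set M
       (sets (vimage_algebra (space M) (\<lambda>\<omega> k. waiting_time T k \<omega>) (Pi\<^sub>M UNIV (\<lambda>_. borel))))
       (sets (vimage_algebra (space M) (\<lambda>\<omega> k. e k \<omega>) (Pi\<^sub>M UNIV (\<lambda>_. count_space UNIV))))"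

definition cadlag :: "(real \<Rightarrow> 'a::t2_space) \<Rightarrow> bool" where
  "cadlag f \<longleftrightarrow>
     (\<forall>t\<ge>0. (f \<longlongrightarrow> f t) (at_right t)) \<and> (\<forall>t>0. \<exists>l. (f \<longlongrightarrow> l) (at_left t))"

definition left_limit :: "(real \<Rightarrow> 'a::t2_space) \<Rightarrow> real \<Rightarrow> 'a" where
  "left_limit f t = Lim (at_left t) f"

(* Deterministic description of one trajectory (x, z), for activation times T k and activated
   edges e k. The jump rule is invariant under exchanging the endpoints v and w of the edge;
   at times t > 0 without activation the differential equations hold at t. *)
definition accelerated_gossip_path ::
  "real \<Rightarrow> real \<Rightarrow> (nat \<Rightarrow> real) \<Rightarrow> (nat \<Rightarrow> 'v set) \<Rightarrow>
   (real \<Rightarrow> real^'v) \<Rightarrow> (real \<Rightarrow> real^'v) \<Rightarrow> bool" where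
  "accelerated_gossip_path \<mu> R T e x z \<longleftrightarrow>
     cadlag x \<and> cadlag z \<and>
     (\<forall>k v w. e k = {v, w} \<longrightarrow>
        (let x' = left_limit x (T k); z' = left_limit z (T k) in
          x (T k) $ v = (x' $ v + x' $ w) / 2 \<and>
          x (T k) $ w = (x' $ v + x' $ w) / 2 \<and>
          z (T k) $ v = z' $ v + 1 / sqrt (2 * \<mu> * R) * (x' $ w - x' $ v) \<and>
          z (T k) $ w = z' $ w + 1 / sqrt (2 * \<mu> * R) * (x' $ v - x' $ w) \<and>
          (\<forall>u. u \<noteq> v \<and> u \<noteq> w \<longrightarrow> x (T k) $ u = x' $ u \<and> z (T k) $ u = z' $ u))) \<and>
     (\<forall>t>0. t \<notin> range T \<longrightarrow> (\<forall>v.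
        ((\<lambda>s. x s $ v) has_real_derivative sqrt (\<mu> / (2 * R)) * (z t $ v - x t $ v)) (at t) \<and>
        ((\<lambda>s. z s $ v) has_real_derivative sqrt (\<mu> / (2 * R)) * (x t $ v - z t $ v)) (at t)))"

end

theory Submission
  imports Defs
begin

text \<open>Let \<open>C\<close> be the projection onto the mean-free vectors, \<open>L\<close> the Laplacian, \<open>\<mu>\<close> its spectral
  gap and \<open>\<theta> = sqrt (\<mu> / (2 R))\<close>.  The quadratic form \<open>V(x, z) = \<bar>C x\<bar>\<^sup>2 / 2 + \<mu> / 2 * z \<bullet> L\<^sup>+ z\<close> decays in mean at
  rate \<open>\<theta>\<close>: in the generator, the cross terms of the jumps average to \<open>x \<bullet> C z\<close> because \<open>L L\<^sup>+ = C\<close>,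
  the second-order terms in \<open>z\<close> are absorbed by those in \<open>x\<close> through the bound on the effective resistances,
  and \<open>\<mu> L\<^sup>+ \<le> C\<close> controls the remainder.

  The expectation is computed along the embedded jump chain.  Let \<open>S\<^sub>k\<close> be the time of the \<open>k\<close>-th
  activation, \<open>W\<^sub>k\<close> the mean of \<open>exp (\<theta> S\<^sub>k) V\<close> at time \<open>S\<^sub>k\<close> on \<open>S\<^sub>k \<le> t\<close>, and \<open>A\<^sub>k\<close> the mean of
  \<open>exp (\<theta> t) V\<close> at time \<open>t\<close> on \<open>S\<^sub>k \<le> t < S\<^sub>k\<^sub>+\<^sub>1\<close>.  Integrating over one exponential waiting time and one
  edge gives \<open>A\<^sub>k + W\<^sub>k\<^sub>+\<^sub>1 \<le> W\<^sub>k\<close>; summing over \<open>k\<close>, which is legitimate since the activation times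
  do not accumulate, bounds the mean of \<open>exp (\<theta> t) V\<close> at time \<open>t\<close> by the initial value.\<close>

section \<open>The Laplacian, its spectral gap and its pseudo-inverse\<close>

text \<open>The orientation is arbitrary: only expressions even in the edge vector occur.\<close>

definition edge_vec :: "'v::finite set \<Rightarrow> real^'v" where
  "edge_vec e = (SOME b. \<exists>v w. e = {v, w} \<and> b = axis v 1 - axis w 1)"

lemma edge_vec_cases:
  assumes "card e = 2"
  obtains v w where "e = {v, w}" "v \<noteq> w" "edge_vec e = axis v 1 - axis w 1"
proof -
  from assms obtain v w where "e = {v, w}" "v \<noteq> w"
    by (auto simp: card_2_iff)
  then have "\<exists>b. \<exists>v w. e = {v, w} \<and> b = (axis v 1 - axis w 1 :: real^'a)" by blast
  from someI_ex[OF this] obtain v' w'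
    where "e = {v', w'}" "edge_vec e = (axis v' 1 - axis w' 1 :: real^'a)"
    unfolding edge_vec_def by blast
  moreover from this assms have "v' \<noteq> w'" by auto
  ultimately show thesis using that by blast
qed

text \<open>The choice in \<open>edge_vec\<close> leaves the sign open, since a two-element set can
  be read in either order.\<close>

lemma edge_vec_pair:
  assumes "v \<noteq> w"
  shows "edge_vec {v, w} = axis v 1 - axis w 1 \<or> edge_vec {v, w} = - (axis v 1 - axis w 1)"
proof -
  have "card {v, w} = 2" using assms by simp
  then show ?thesis
    by (rule edge_vec_cases) (auto simp: doubleton_eq_iff)
qed

section \<open>The orthogonal projections onto mean-free and onto constant vectors\<close>

lemma inner_one_vec: "1 \<bullet> (x :: real^'v::finite) = (\<Sum>v\<in>UNIV. x $ v)"
  by (simp add: inner_vec_def)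

definition centre :: "real^'v::finite \<Rightarrow> real^'v" where
  "centre x = x - ((1 \<bullet> x) / real CARD('v)) *\<^sub>R 1"

text \<open>The projection complementary to \<open>centre\<close>, onto the constant vectors, which
  form the kernel of the Laplacian of a connected graph.\<close>

definition mean_matrix :: "real^'v::finite^'v" where
  "mean_matrix = (\<chi> i j. 1 / real CARD('v))"

lemma one_inner_one: "(1 :: real^'v::finite) \<bullet> 1 = real CARD('v)"
  by (simp add: inner_one_vec)

lemma mean_matrix_mult: "mean_matrix *v x = ((1 \<bullet> x) / real CARD('v)) *\<^sub>R (1 :: real^'v::finite)"
  by (simp add: vec_eq_iff mean_matrix_def matrix_vector_mult_def inner_one_vec sum_divide_distrib)

lemma centre_eq: "centre x = (mat 1 - mean_matrix) *v x"
  by (simp add: centre_def mean_matrix_mult matrix_vector_mult_diff_rdistrib)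

lemma centre_add: "centre (x + y) = centre x + centre y"
  and centre_diff: "centre (x - y) = centre x - centre y"
  and centre_scaleR: "centre (a *\<^sub>R x) = a *\<^sub>R centre x"
  by (simp_all add: centre_eq matrix_vector_right_distrib matrix_vector_mult_diff_distrib
      matrix_vector_mult_scaleR)

lemma one_inner_centre [simp]: "1 \<bullet> centre x = 0"
  by (simp add: centre_def inner_diff_right one_inner_one)

lemma centre_orthogonal: "1 \<bullet> x = 0 \<Longrightarrow> centre x = x"
  by (simp add: centre_def)

text \<open>Self-adjointness and idempotence of the projection in one identity.\<close>

lemma centre_inner_centre: "centre x \<bullet> centre y = x \<bullet> centre y"
  by (subst (1) centre_def) (simp add: inner_diff_left)

text \<open>Penrose's argument: \<open>A ** B\<close> and \<open>A ** C\<close> are symmetric and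
  each absorbs the other on its right, so transposing their product identifies them; likewise
  \<open>B ** A\<close> and \<open>C ** A\<close>. Then B = BAB = CAC = C.\<close>

lemma is_pseudo_inverse_unique:
  fixes A :: "real^'n::finite^'m::finite"
  assumes "is_pseudo_inverse A B" "is_pseudo_inverse A C"
  shows "B = C"
proof -
  have AB: "A ** B = A ** C"
  proof -
    have "A ** B = transpose (A ** B)" using assms by (simp add: is_pseudo_inverse_def)
    also have "\<dots> = transpose ((A ** C) ** (A ** B))"
      using assms by (simp add: is_pseudo_inverse_def matrix_mul_assoc)
    also have "\<dots> = (A ** B) ** (A ** C)"
      using assms by (simp only: matrix_transpose_mul is_pseudo_inverse_def)
    also have "\<dots> = A ** C"
      using assms by (simp add: is_pseudo_inverse_def matrix_mul_assoc)
    finally show ?thesis .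
  qed
  have BA: "B ** A = C ** A"
  proof -
    have "B ** A = transpose (B ** A)" using assms by (simp add: is_pseudo_inverse_def)
    also have "\<dots> = transpose ((B ** A) ** (C ** A))"
      using assms by (simp add: is_pseudo_inverse_def flip: matrix_mul_assoc)
    also have "\<dots> = (C ** A) ** (B ** A)"
      using assms by (simp only: matrix_transpose_mul is_pseudo_inverse_def)
    also have "\<dots> = C ** A"
      using assms by (simp add: is_pseudo_inverse_def flip: matrix_mul_assoc)
    finally show ?thesis .
  qed
  have "B = B ** (A ** B)" using assms by (simp add: is_pseudo_inverse_def matrix_mul_assoc)
  also have "\<dots> = C ** A ** C" by (simp add: AB matrix_mul_assoc BA)
  finally show ?thesis using assms by (simp add: is_pseudo_inverse_def)
qed

lemma pseudo_inverse_eqI: "is_pseudo_inverse A B \<Longrightarrow> pseudo_inverse A = B"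
  for A :: "real^'n::finite^'m::finite"
  unfolding pseudo_inverse_def by (rule the_equality) (auto intro: is_pseudo_inverse_unique)

lemma matrix_mult_distribs:
  fixes A B :: "real^'n::finite^'m::finite" and C D :: "real^'k::finite^'n::finite"
  shows matrix_mult_add_right: "(A + B) ** C = A ** C + B ** C"
    and matrix_mult_diff_right: "(A - B) ** C = A ** C - B ** C"
    and matrix_mult_diff_left: "A ** (C - D) = A ** C - A ** D"
  by (simp_all add: matrix_matrix_mult_def vec_eq_iff sum.distrib sum_subtractf algebra_simps)

text \<open>First-order optimality condition: near 0 a nonzero linear term would dominate the
  quadratic one and change sign. It serves to show that a Rayleigh minimiser is an
  eigenvector.\<close>

lemma linear_term_zero:
  fixes a K :: real
  assumes "\<And>s. 2 * s * a + s\<^sup>2 * K \<ge> 0"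
  shows "a = 0"
proof -
  define d where "d = \<bar>K\<bar> + 1"
  have d: "d > 0" "K \<le> d" by (auto simp: d_def)
  \<comment> \<open>The value \<open>- a / d\<close> minimises
    \<open>2 * s * a + s\<^sup>2 * d\<close>, where \<open>d\<close> is a positive upper bound of
    \<open>K\<close>.\<close>
  have "0 \<le> 2 * (- a / d) * a + (- a / d)\<^sup>2 * K" by (rule assms)
  also have "\<dots> \<le> 2 * (- a / d) * a + (- a / d)\<^sup>2 * d"
    using d by (intro add_left_mono mult_left_mono) auto
  also have "\<dots> = - (a\<^sup>2 / d)" using d by (simp add: field_simps power2_eq_square)
  finally show ?thesis using d by (simp add: divide_le_0_iff)
qed

text \<open>The equation \<open>support\<close> encodes both that the edge law lives on
  \<open>E\<close> and that every edge has positive weight.\<close>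

locale gossip_graph =
  fixes E :: "'v::finite set set" and P :: "'v set pmf"
  assumes graph: "connected_simple_graph E"
    and two_vertices: "CARD('v) \<ge> 2"
    and support: "set_pmf P = E"
begin

abbreviation Lap :: "real^'v^'v" where "Lap \<equiv> laplacian E P"
abbreviation pinv :: "real^'v^'v" where "pinv \<equiv> pseudo_inverse Lap"
abbreviation gap :: real where "gap \<equiv> gossip_gap E P"
abbreviation Rmax :: real where "Rmax \<equiv> max_resistance E P"

lemma card_edge: "e \<in> E \<Longrightarrow> card e = 2"
  using graph by (simp add: connected_simple_graph_def)

lemma edge_distinct: "{v, w} \<in> E \<Longrightarrow> v \<noteq> w"
  using card_edge by fastforce

section \<open>The Laplacian and its quadratic form as sums over edges\<close>

lemma laplacian_mult_component:
  "(Lap *v x) $ v = (\<Sum>w | {v, w} \<in> E. pmf P {v, w} * (x $ v - x $ w))"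
proof -
  have "(Lap *v x) $ v = (\<Sum>w\<in>UNIV. Lap $ v $ w * x $ w)"
    by (simp add: matrix_vector_mult_def)
  also have "\<dots> = Lap $ v $ v * x $ v + (\<Sum>w\<in>UNIV - {v}. Lap $ v $ w * x $ w)"
    by (simp add: sum.remove)
  also have "(\<Sum>w\<in>UNIV - {v}. Lap $ v $ w * x $ w) = (\<Sum>w | {v, w} \<in> E. - pmf P {v, w} * x $ w)"
    using edge_distinct
    by (intro sum.mono_neutral_cong_right) (auto simp: laplacian_def)
  also have "Lap $ v $ v * x $ v = (\<Sum>w | {v, w} \<in> E. pmf P {v, w} * x $ v)"
    by (simp add: laplacian_def sum_distrib_right)
  finally show ?thesis
    by (simp add: right_diff_distrib sum_subtractf sum_negf)
qed

text \<open>The Laplacian is the weighted sum of the rank-one matrices b b^T over the edge vectors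
  b. Coordinate \<open>v\<close> only receives the edges through \<open>v\<close>, and the unknown
  sign of each edge vector occurs twice, hence cancels.\<close>

lemma laplacian_mult: "Lap *v x = (\<Sum>e\<in>E. (pmf P e * (edge_vec e \<bullet> x)) *\<^sub>R edge_vec e)"
proof (subst vec_eq_iff, rule allI)
  fix v
  have "(\<Sum>e\<in>E. (pmf P e * (edge_vec e \<bullet> x)) *\<^sub>R edge_vec e) $ v
      = (\<Sum>e\<in>E. pmf P e * (edge_vec e \<bullet> x) * edge_vec e $ v)"
    by simp
  also have "\<dots> = (\<Sum>e\<in>{e\<in>E. v \<in> e}. pmf P e * (edge_vec e \<bullet> x) * edge_vec e $ v)"
  proof (rule sum.mono_neutral_right)
    show "\<forall>e\<in>E - {e \<in> E. v \<in> e}. pmf P e * (edge_vec e \<bullet> x) * edge_vec e $ v = 0"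
    proof
      fix e assume e: "e \<in> E - {e \<in> E. v \<in> e}"
      then have "card e = 2" using card_edge by auto
      then show "pmf P e * (edge_vec e \<bullet> x) * edge_vec e $ v = 0"
        by (rule edge_vec_cases) (use e in \<open>auto simp: axis_def\<close>)
    qed
  qed auto
  also have "{e\<in>E. v \<in> e} = (\<lambda>w. {v, w}) ` {w. {v, w} \<in> E}"
  proof (intro equalityI subsetI)
    fix e assume e: "e \<in> {e\<in>E. v \<in> e}"
    then obtain a b where "e = {a, b}" using card_edge[of e] by (auto simp: card_2_iff)
    with e show "e \<in> (\<lambda>w. {v, w}) ` {w. {v, w} \<in> E}" by (auto simp: insert_commute)
  qed auto
  also have "(\<Sum>e\<in>(\<lambda>w. {v, w}) ` {w. {v, w} \<in> E}. pmf P e * (edge_vec e \<bullet> x) * edge_vec e $ v)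
      = (\<Sum>w | {v, w} \<in> E. pmf P {v, w} * (edge_vec {v, w} \<bullet> x) * edge_vec {v, w} $ v)"
    by (subst sum.reindex) (auto simp: inj_on_def doubleton_eq_iff)
  also have "\<dots> = (\<Sum>w | {v, w} \<in> E. pmf P {v, w} * (x $ v - x $ w))"
  proof (rule sum.cong[OF refl])
    fix w assume "w \<in> {w. {v, w} \<in> E}"
    then have "v \<noteq> w" using edge_distinct by auto
    then have "(axis v 1 - axis w 1 :: real^'v) \<bullet> x = x $ v - x $ w"
      "(axis v 1 - axis w 1 :: real^'v) $ v = 1"
      by (simp_all add: inner_diff_left inner_axis') (simp add: axis_def)
    then have "(edge_vec {v, w} \<bullet> x) * edge_vec {v, w} $ v = x $ v - x $ w"
      using edge_vec_pair[OF \<open>v \<noteq> w\<close>] by (auto simp: inner_minus_left simp del: minus_diff_eq)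
    then show "pmf P {v, w} * (edge_vec {v, w} \<bullet> x) * edge_vec {v, w} $ v = pmf P {v, w} * (x $ v - x $ w)"
      by (simp add: mult.assoc)
  qed
  finally show "(Lap *v x) $ v = (\<Sum>e\<in>E. (pmf P e * (edge_vec e \<bullet> x)) *\<^sub>R edge_vec e) $ v"
    by (simp add: laplacian_mult_component)
qed

lemma inner_laplacian: "y \<bullet> (Lap *v x) = (\<Sum>e\<in>E. pmf P e * (edge_vec e \<bullet> x) * (edge_vec e \<bullet> y))"
  by (simp add: laplacian_mult inner_sum_right inner_commute)

lemma inner_laplacian_commute: "y \<bullet> (Lap *v x) = x \<bullet> (Lap *v y)"
  by (simp add: inner_laplacian mult_ac)

lemma one_inner_edge_vec: "e \<in> E \<Longrightarrow> 1 \<bullet> edge_vec e = 0"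
  by (rule edge_vec_cases[OF card_edge, of e]) (auto simp: inner_diff_right inner_axis)

lemma centre_edge_vec: "e \<in> E \<Longrightarrow> centre (edge_vec e) = edge_vec e"
  by (intro centre_orthogonal one_inner_edge_vec)

lemma edge_vec_inner_self: "e \<in> E \<Longrightarrow> edge_vec e \<bullet> edge_vec e = 2"
  by (rule edge_vec_cases[OF card_edge, of e])
    (auto simp: inner_diff_right inner_diff_left inner_axis, auto simp: axis_def)

lemma laplacian_one: "Lap *v 1 = 0"
  by (simp add: laplacian_mult inner_commute one_inner_edge_vec)

lemma one_inner_laplacian: "1 \<bullet> (Lap *v x) = 0"
  by (subst inner_laplacian_commute) (simp add: laplacian_one)

lemma laplacian_nonneg: "x \<bullet> (Lap *v x) \<ge> 0"
  by (auto simp: inner_laplacian mult.assoc intro!: sum_nonneg)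

text \<open>The form is a sum of squares with positive weights, so its vanishing makes
  \<open>x\<close> agree across each edge; connectivity propagates this to all vertices.\<close>

lemma laplacian_kernel:
  assumes "x \<bullet> (Lap *v x) = 0"
  shows "centre x = 0"
proof -
  have nn: "\<And>e. e \<in> E \<Longrightarrow> 0 \<le> pmf P e * (edge_vec e \<bullet> x) * (edge_vec e \<bullet> x)"
    by (simp add: mult.assoc)
  have zero: "edge_vec e \<bullet> x = 0" if "e \<in> E" for e
  proof -
    have "pmf P e * (edge_vec e \<bullet> x) * (edge_vec e \<bullet> x) = 0"
      using assms sum_nonneg_0[of E "\<lambda>e. pmf P e * (edge_vec e \<bullet> x) * (edge_vec e \<bullet> x)" e] nn that
      by (simp add: inner_laplacian)
    moreover have "pmf P e \<noteq> 0" using that support by (auto simp: set_pmf_eq)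
    ultimately show ?thesis by simp
  qed
  have step: "x $ v = x $ w" if "{v, w} \<in> E" for v w
    using zero[OF that] edge_vec_pair[OF edge_distinct[OF that]]
    by (auto simp: inner_diff_left inner_axis' inner_minus_left)
  have const: "x $ v = x $ w" for v w
  proof -
    have "(v, w) \<in> {(a, b). {a, b} \<in> E}\<^sup>*" using graph by (simp add: connected_simple_graph_def)
    then show ?thesis by (induction rule: rtrancl_induct) (auto dest: step)
  qed
  then have "x = (x $ undefined) *\<^sub>R 1" by (auto simp: vec_eq_iff)
  moreover have "centre 1 = (0 :: real^'v)" by (simp add: centre_def one_inner_one)
  ultimately show ?thesis by (metis centre_scaleR scaleR_zero_right)
qed

text \<open>With J the mean matrix, the pseudo-inverse is (L + J)^{-1} - J: adding the projection
  onto the kernel makes the Laplacian invertible, and subtracting it afterwards restores the value 0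
  on constants.\<close>

lemma pinv_exists:
  shows laplacian_pinv: "Lap ** pinv = mat 1 - mean_matrix"
    and mean_matrix_pinv: "mean_matrix ** pinv = 0"
proof -
  let ?J = "mean_matrix :: real^'v^'v"
  have LJ: "Lap ** ?J = 0"
    by (subst matrix_eq) (simp add: mean_matrix_mult laplacian_one matrix_vector_mult_scaleR
        flip: matrix_vector_mul_assoc)
  have JL: "?J ** Lap = 0"
    by (subst matrix_eq) (simp add: mean_matrix_mult one_inner_laplacian flip: matrix_vector_mul_assoc)
  have JJ: "?J ** ?J = ?J"
    by (subst matrix_eq) (simp add: mean_matrix_mult one_inner_one flip: matrix_vector_mul_assoc)
  \<comment> \<open>Both forms are nonnegative, so both vanish: one makes \<open>x\<close> constant,
    the other makes its mean zero.\<close>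
  have "x = 0" if "(Lap + ?J) *v x = 0" for x
  proof -
    have "x \<bullet> (Lap *v x) + x \<bullet> (?J *v x) = 0"
      using that by (metis inner_add_right inner_zero_right matrix_vector_mult_add_rdistrib)
    then have "x \<bullet> (Lap *v x) + (1 \<bullet> x)\<^sup>2 / real CARD('v) = 0"
      by (simp add: mean_matrix_mult power2_eq_square inner_commute)
    moreover have "(1 \<bullet> x)\<^sup>2 / real CARD('v) \<ge> 0" by simp
    ultimately have "x \<bullet> (Lap *v x) = 0" "(1 \<bullet> x)\<^sup>2 / real CARD('v) = 0"
      using laplacian_nonneg[of x] by linarith+
    then show ?thesis using laplacian_kernel[of x] by (simp add: centre_orthogonal)
  qed
  then obtain G where G: "G ** (Lap + ?J) = mat 1"
    using matrix_left_invertible_ker by blast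
  then have G': "(Lap + ?J) ** G = mat 1"
    by (simp add: matrix_left_right_inverse)
  have GJ: "G ** ?J = ?J"
  proof -
    have "?J = G ** ((Lap + ?J) ** ?J)" by (simp add: matrix_mul_assoc G)
    also have "\<dots> = G ** ?J" by (simp add: matrix_mult_add_right LJ JJ)
    finally show ?thesis by simp
  qed
  have JG: "?J ** G = ?J"
  proof -
    have "?J = (?J ** (Lap + ?J)) ** G" by (simp add: G' flip: matrix_mul_assoc)
    also have "\<dots> = ?J ** G" by (simp add: matrix_add_ldistrib JL JJ)
    finally show ?thesis by simp
  qed
  have LG: "Lap ** G = mat 1 - ?J"
    using G' by (simp add: matrix_mult_add_right JG algebra_simps)
  have GL: "G ** Lap = mat 1 - ?J"
    using G by (simp add: matrix_add_ldistrib GJ algebra_simps)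
  have sym: "transpose (mat 1 - ?J) = mat 1 - ?J"
    by (simp add: transpose_def mat_def mean_matrix_def vec_eq_iff)
  have LB: "Lap ** (G - ?J) = mat 1 - ?J"
    by (simp add: matrix_mult_diff_left LG LJ)
  have BL: "(G - ?J) ** Lap = mat 1 - ?J"
    by (simp add: matrix_mult_diff_right GL JL)
  have "is_pseudo_inverse Lap (G - ?J)"
    unfolding is_pseudo_inverse_def LB BL sym
    by (simp add: matrix_mult_diff_right JL JG JJ matrix_mult_diff_left)
  then have pinv: "pinv = G - ?J" by (rule pseudo_inverse_eqI)
  show "Lap ** pinv = mat 1 - ?J" unfolding pinv by (rule LB)
  show "?J ** pinv = 0" unfolding pinv by (simp add: matrix_mult_diff_left JG JJ)
qed

section \<open>Symmetry and positivity of the pseudo-inverse\<close>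

lemma laplacian_pinv_mult: "Lap *v (pinv *v x) = centre x"
  by (simp add: matrix_vector_mul_assoc laplacian_pinv centre_eq)

lemma one_inner_pinv: "1 \<bullet> (pinv *v x) = 0"
proof -
  have "mean_matrix *v (pinv *v x) = 0"
    by (simp add: matrix_vector_mul_assoc mean_matrix_pinv)
  then show ?thesis by (simp add: mean_matrix_mult)
qed

lemma centre_inner_pinv: "centre x \<bullet> (pinv *v y) = x \<bullet> (pinv *v y)"
  by (simp add: centre_def inner_diff_left one_inner_pinv)

text \<open>Replacing \<open>x\<close> by its projection \<open>Lap *v (pinv *v x)\<close> rewrites
  the form of the pseudo-inverse through that of the Laplacian, from which it inherits symmetry and
  positivity.\<close>

lemma inner_pinv: "x \<bullet> (pinv *v y) = (pinv *v x) \<bullet> (Lap *v (pinv *v y))"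
  by (metis centre_inner_pinv laplacian_pinv_mult inner_laplacian_commute inner_commute)

lemma inner_pinv_commute: "x \<bullet> (pinv *v y) = y \<bullet> (pinv *v x)"
  by (metis inner_pinv inner_laplacian_commute)

lemma pinv_nonneg: "x \<bullet> (pinv *v x) \<ge> 0"
  by (simp add: inner_pinv[of x x] laplacian_nonneg)

text \<open>Rayleigh quotient argument. A minimiser \<open>u\<close> on the unit sphere of mean-free
  vectors exists by compactness and is an eigenvector; its value \<open>l\<close> is positive by
  connectivity. An eigenvector of any positive eigenvalue is mean-free, so \<open>l\<close> is the
  least such eigenvalue; this attained minimum is what gives \<open>LEAST\<close> its meaning over
  the reals.\<close>

lemma gap_variational:
  shows gap_pos: "gap > 0"
    and gap_le: "\<And>x. gap * (centre x \<bullet> centre x) \<le> x \<bullet> (Lap *v x)"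
proof -
  define K where "K = sphere (0::real^'v) 1 \<inter> {x. 1 \<bullet> x = 0}"
  have "compact K"
    unfolding K_def by (intro compact_Int_closed compact_sphere closed_hyperplane)
  moreover have "K \<noteq> {}"
  proof -
    have "\<not> CARD('v) \<le> Suc 0" using two_vertices by simp
    then obtain v w :: 'v where "v \<noteq> w" by (auto simp: card_le_Suc0_iff_eq)
    define y :: "real^'v" where "y = axis v 1 - axis w 1"
    have "y $ v = 1" using \<open>v \<noteq> w\<close> by (simp add: y_def axis_def)
    then have "y \<noteq> 0" by auto
    moreover have "1 \<bullet> y = 0" by (simp add: y_def inner_diff_right inner_axis)
    ultimately have "y /\<^sub>R norm y \<in> K" by (simp add: K_def)
    then show ?thesis by blast
  qed
  moreover have "continuous_on K (\<lambda>x. x \<bullet> (Lap *v x))"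
    by (intro continuous_intros matrix_vector_mult_linear_continuous_on)
  ultimately obtain u where u: "u \<in> K" and min: "\<And>y. y \<in> K \<Longrightarrow> u \<bullet> (Lap *v u) \<le> y \<bullet> (Lap *v y)"
    using continuous_attains_inf[of K "\<lambda>x. x \<bullet> (Lap *v x)"] by auto
  define l where "l = u \<bullet> (Lap *v u)"
  have uu: "u \<bullet> u = 1" and u1: "1 \<bullet> u = 0"
    using u by (auto simp: K_def norm_eq_1)
  have low: "l * (x \<bullet> x) \<le> x \<bullet> (Lap *v x)" if "1 \<bullet> x = 0" for x
  proof (cases "x = 0")
    case False
    then have "x /\<^sub>R norm x \<in> K" using that by (simp add: K_def)
    from min[OF this] have "l \<le> inverse (norm x) * (inverse (norm x) * (x \<bullet> (Lap *v x)))"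
      by (simp add: l_def matrix_vector_mult_scaleR)
    then have "l * (norm x * norm x)
        \<le> inverse (norm x) * (inverse (norm x) * (x \<bullet> (Lap *v x))) * (norm x * norm x)"
      by (rule mult_right_mono) simp
    also have "\<dots> = x \<bullet> (Lap *v x)" using False by (simp add: field_simps)
    finally show ?thesis by (simp add: dot_square_norm power2_eq_square)
  qed simp
  have eig: "Lap *v u = l *\<^sub>R u"
  proof -
    \<comment> \<open>The residual of the eigenvalue equation. Moving \<open>u\<close> along
      \<open>w\<close> stays among the mean-free vectors, and the first-order coefficient of the
      change is \<open>w \<bullet> w\<close>.\<close>
    define w where "w = Lap *v u - l *\<^sub>R u"
    have w1: "1 \<bullet> w = 0" by (simp add: w_def inner_diff_right one_inner_laplacian u1)
    have "0 \<le> 2 * s * (w \<bullet> w) + s\<^sup>2 * (w \<bullet> (Lap *v w) - l * (w \<bullet> w))" for s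
    proof -
      have "l * ((u + s *\<^sub>R w) \<bullet> (u + s *\<^sub>R w)) \<le> (u + s *\<^sub>R w) \<bullet> (Lap *v (u + s *\<^sub>R w))"
        by (rule low) (simp add: inner_add_right u1 w1)
      moreover have "u \<bullet> (Lap *v w) = w \<bullet> (Lap *v u)" by (rule inner_laplacian_commute)
      moreover have "w \<bullet> (Lap *v u) = w \<bullet> w + l * (w \<bullet> u)"
        by (simp add: w_def inner_diff_left inner_diff_right algebra_simps)
      ultimately show ?thesis
        by (simp add: inner_add_left inner_add_right matrix_vector_right_distrib
            matrix_vector_mult_scaleR uu inner_commute[of u w] l_def[symmetric] algebra_simps power2_eq_square)
    qed
    then have "w \<bullet> w = 0" by (rule linear_term_zero)
    then show ?thesis by (simp add: w_def)
  qed
  have "l \<ge> 0" unfolding l_def by (rule laplacian_nonneg)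
  moreover have "l \<noteq> 0"
    using laplacian_kernel[of u] uu u1 by (auto simp: l_def centre_orthogonal)
  ultimately have "l > 0" by simp
  have "gap = l"
    unfolding gossip_gap_def
  proof (rule Least_equality)
    show "0 < l \<and> is_eigenvalue Lap l"
      using \<open>l > 0\<close> eig uu by (auto simp: is_eigenvalue_def intro!: exI[of _ u])
  next
    fix m assume m: "0 < m \<and> is_eigenvalue Lap m"
    then obtain y where y: "y \<noteq> 0" "Lap *v y = m *\<^sub>R y" by (auto simp: is_eigenvalue_def)
    \<comment> \<open>Pairing the eigenvalue equation with the constant vector gives
      \<open>m * (1 \<bullet> y) = 0\<close>.\<close>
    have "1 \<bullet> y = 0" using one_inner_laplacian[of y] m y by simp
    from low[OF this] have "l * (y \<bullet> y) \<le> m * (y \<bullet> y)" using y by simp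
    then show "l \<le> m" using y by simp
  qed
  then show "gap > 0" using \<open>l > 0\<close> by simp
  fix x
  have "l * (centre x \<bullet> centre x) \<le> centre x \<bullet> (Lap *v centre x)" by (rule low) simp
  also have "Lap *v centre x = Lap *v x"
    by (simp add: centre_def matrix_vector_mult_diff_distrib matrix_vector_mult_scaleR laplacian_one)
  also have "centre x \<bullet> (Lap *v x) = x \<bullet> (Lap *v x)"
    by (simp add: centre_def inner_diff_left one_inner_laplacian)
  finally show "gap * (centre x \<bullet> centre x) \<le> x \<bullet> (Lap *v x)" using \<open>gap = l\<close> by simp
qed

text \<open>With \<open>y = pinv *v x\<close> and \<open>a = x \<bullet> y\<close>, the variational
  bound gives \<open>gap * (y \<bullet> y) \<le> a\<close>. Inserting this in the expansion of the
  square of \<open>centre x - gap *\<^sub>R y\<close>, which is nonnegative, gives the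
  claim.\<close>

lemma pinv_le: "gap * (x \<bullet> (pinv *v x)) \<le> centre x \<bullet> centre x"
proof -
  define y where "y = pinv *v x"
  define a where "a = x \<bullet> y"
  have cy: "centre y = y" unfolding y_def by (intro centre_orthogonal one_inner_pinv)
  have a: "a = centre x \<bullet> y" by (simp add: a_def y_def centre_inner_pinv)
  have "a = y \<bullet> (Lap *v y)" by (simp add: a_def y_def inner_pinv)
  then have "gap * (y \<bullet> y) \<le> a" using gap_le[of y] cy by simp
  moreover have "0 \<le> (centre x - gap *\<^sub>R y) \<bullet> (centre x - gap *\<^sub>R y)" by simp
  then have "0 \<le> centre x \<bullet> centre x - 2 * gap * a + gap * (gap * (y \<bullet> y))"
    by (simp add: inner_diff_left inner_diff_right a inner_commute algebra_simps)
  moreover have "gap * (gap * (y \<bullet> y)) \<le> gap * a" using calculation(1) gap_pos by simp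
  ultimately show ?thesis unfolding a_def y_def by (simp add: mult.assoc)
qed

section \<open>Bounds on the effective resistances\<close>

lemma edge_resistance_le:
  assumes "e \<in> E"
  shows "edge_vec e \<bullet> (pinv *v edge_vec e) \<le> Rmax"
proof -
  obtain v w where vw: "e = {v, w}" "edge_vec e = axis v 1 - axis w 1"
    using edge_vec_cases[OF card_edge[OF assms]] by metis
  have "finite {effective_resistance E P v w | v w. {v, w} \<in> E}"
    by (rule finite_subset[of _ "(\<lambda>(v, w). effective_resistance E P v w) ` UNIV"]) auto
  moreover have "edge_vec e \<bullet> (pinv *v edge_vec e) \<in> {effective_resistance E P v w | v w. {v, w} \<in> E}"
    using vw assms by (auto simp: effective_resistance_def)
  ultimately show ?thesis unfolding max_resistance_def by (rule Max_ge)
qed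

text \<open>Zero resistance of an edge would force its image under \<open>pinv\<close> to vanish,
  hence also the projection of the edge vector, which is the nonzero edge vector itself.\<close>

lemma Rmax_pos: "Rmax > 0"
proof -
  obtain e where e: "e \<in> E" using support set_pmf_not_empty by fast
  define y where "y = pinv *v edge_vec e"
  have "y \<bullet> (Lap *v y) \<noteq> 0"
  proof
    assume "y \<bullet> (Lap *v y) = 0"
    then have "centre y = 0" by (rule laplacian_kernel)
    then have "y = 0" using one_inner_pinv[of "edge_vec e"] by (simp add: y_def centre_orthogonal)
    then have "edge_vec e = 0"
      using laplacian_pinv_mult[of "edge_vec e"] centre_edge_vec[OF e] by (simp add: y_def)
    then show False using edge_vec_inner_self[OF e] by simp
  qed
  then have "0 < y \<bullet> (Lap *v y)" using laplacian_nonneg[of y] by simp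
  also have "\<dots> \<le> Rmax" using edge_resistance_le[OF e] by (simp add: y_def inner_pinv)
  finally show ?thesis .
qed

end

section \<open>The Lyapunov function\<close>

lemma exp_tail_nn_integral:
  "(\<integral>\<^sup>+ s. ennreal (K * exp (- s)) * indicator {r..} s \<partial>lborel) = ennreal (K * exp (- r))"
  if "K \<ge> 0" for K r :: real
proof -
  have "((\<lambda>s::real. - K * exp (- s)) \<longlongrightarrow> - K * 0) at_top"
    by (intro tendsto_intros filterlim_compose[OF exp_at_bot] filterlim_uminus_at_bot_at_top)
  then have "(\<integral>\<^sup>+ s. ennreal (K * exp (- s)) * indicator {r..} s \<partial>lborel)
      = ennreal (0 - (- K * exp (- r)))"
    using that by (intro nn_integral_FTC_atLeast) (auto intro!: derivative_eq_intros)
  then show ?thesis by simp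
qed

context gossip_graph
begin

text \<open>\<open>rate\<close> is both the coefficient of the differential equations and the decay
  rate to be proved; \<open>gain\<close> is the step size of \<open>z\<close> at an
  activation.\<close>

definition rate :: real where "rate = sqrt (gap / (2 * Rmax))"
definition gain :: real where "gain = 1 / sqrt (2 * gap * Rmax)"

definition lyap :: "(real^'v) \<times> (real^'v) \<Rightarrow> real" where
  "lyap \<xi> = 1/2 * (centre (fst \<xi>) \<bullet> centre (fst \<xi>)) + gap/2 * (snd \<xi> \<bullet> (pinv *v snd \<xi>))"

text \<open>The derivative of \<open>lyap\<close> in the direction of the field
  \<open>rate * (z - x, x - z)\<close> of the differential equations.\<close>

definition drift :: "(real^'v) \<times> (real^'v) \<Rightarrow> real" where
  "drift \<xi> = rate * (centre (fst \<xi>) \<bullet> centre (snd \<xi> - fst \<xi>))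
    + gap * rate * (snd \<xi> \<bullet> (pinv *v (fst \<xi> - snd \<xi>)))"

text \<open>Since the edge vector has squared norm 2, the averaging of \<open>x\<close> is the
  orthogonal projection onto its complement. Both components are even in the edge vector, so its
  orientation is immaterial.\<close>

definition jump :: "'v set \<Rightarrow> (real^'v) \<times> (real^'v) \<Rightarrow> (real^'v) \<times> (real^'v)" where
  "jump e \<xi> = (fst \<xi> - ((edge_vec e \<bullet> fst \<xi>) / 2) *\<^sub>R edge_vec e,
     snd \<xi> - (gain * (edge_vec e \<bullet> fst \<xi>)) *\<^sub>R edge_vec e)"

text \<open>The explicit solution of the linear system: the sum of the two components is conserved
  and their difference decays at rate \<open>2 * rate\<close>.\<close>

definition flow :: "real \<Rightarrow> (real^'v) \<times> (real^'v) \<Rightarrow> (real^'v) \<times> (real^'v)" where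
  "flow s \<xi> = ((1/2) *\<^sub>R (fst \<xi> + snd \<xi>) + (exp (- 2 * rate * s) / 2) *\<^sub>R (fst \<xi> - snd \<xi>),
     (1/2) *\<^sub>R (fst \<xi> + snd \<xi>) - (exp (- 2 * rate * s) / 2) *\<^sub>R (fst \<xi> - snd \<xi>))"

lemma rate_pos: "rate > 0"
  using gap_pos Rmax_pos by (simp add: rate_def)

lemma gap_gain: "gap * gain = rate"
proof -
  have "gap = sqrt gap * sqrt gap" using gap_pos by simp
  then show ?thesis
    using gap_pos Rmax_pos unfolding rate_def gain_def
    by (simp add: real_sqrt_divide real_sqrt_mult field_simps)
qed

lemma gain_sq: "gap * gain\<^sup>2 * Rmax = 1/2"
  using gap_pos Rmax_pos by (simp add: gain_def power_divide)

lemma lyap_nonneg: "lyap \<xi> \<ge> 0"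
  using gap_pos pinv_nonneg by (simp add: lyap_def)

lemma flow_0: "flow 0 \<xi> = \<xi>"
  by (simp add: flow_def prod_eq_iff vec_eq_iff field_simps)

text \<open>With \<open>s\<close> the difference of \<open>x\<close> along the edge, averaging
  lowers the \<open>x\<close> part by \<open>s\<^sup>2 / 4\<close>. By \<open>gain_sq\<close> and
  the resistance bound, the second-order increase of the \<open>z\<close> part is at most this
  amount, leaving only the cross term, whose coefficient \<open>gap * gain\<close> equals
  \<open>rate\<close>.\<close>

lemma lyap_jump_le:
  assumes "e \<in> E"
  shows "lyap (jump e \<xi>) \<le> lyap \<xi> - rate * ((edge_vec e \<bullet> fst \<xi>) * (edge_vec e \<bullet> (pinv *v snd \<xi>)))"
proof -
  define b s where "b = edge_vec e" and "s = b \<bullet> fst \<xi>"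
  have bb: "b \<bullet> b = 2" using assms by (simp add: b_def edge_vec_inner_self)
  have cb: "centre b = b" using assms by (simp add: b_def centre_edge_vec)
  have cx: "centre (fst \<xi>) \<bullet> b = s"
    using centre_inner_centre[of "fst \<xi>" b] by (simp add: cb s_def inner_commute)
  have x: "centre (fst \<xi> - (s/2) *\<^sub>R b) \<bullet> centre (fst \<xi> - (s/2) *\<^sub>R b)
      = centre (fst \<xi>) \<bullet> centre (fst \<xi>) - s\<^sup>2 / 2"
    by (simp add: centre_diff centre_scaleR cb inner_diff_left inner_diff_right cx bb
        inner_commute[of b "centre (fst \<xi>)"] power2_eq_square)
  have z: "(snd \<xi> - (gain * s) *\<^sub>R b) \<bullet> (pinv *v (snd \<xi> - (gain * s) *\<^sub>R b))
      = snd \<xi> \<bullet> (pinv *v snd \<xi>) - 2 * gain * s * (b \<bullet> (pinv *v snd \<xi>))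
        + gain\<^sup>2 * s\<^sup>2 * (b \<bullet> (pinv *v b))"
    by (simp add: matrix_vector_mult_diff_distrib matrix_vector_mult_scaleR inner_diff_left
        inner_diff_right inner_pinv_commute[of "snd \<xi>" b] power2_eq_square algebra_simps)
  have "gap * gain\<^sup>2 * (b \<bullet> (pinv *v b)) \<le> gap * gain\<^sup>2 * Rmax"
    using edge_resistance_le[OF assms] gap_pos by (simp add: b_def mult_left_mono)
  then have "gap * gain\<^sup>2 * (b \<bullet> (pinv *v b)) * s\<^sup>2 \<le> 1/2 * s\<^sup>2"
    unfolding gain_sq by (rule mult_right_mono) simp
  moreover have "jump e \<xi> = (fst \<xi> - (s/2) *\<^sub>R b, snd \<xi> - (gain * s) *\<^sub>R b)"
    by (simp add: jump_def b_def s_def)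
  then have "lyap (jump e \<xi>) = lyap \<xi> - s\<^sup>2 / 4 - (gap * gain) * (s * (b \<bullet> (pinv *v snd \<xi>)))
      + 1/2 * (gap * gain\<^sup>2 * (b \<bullet> (pinv *v b)) * s\<^sup>2)"
    by (simp only: lyap_def fst_conv snd_conv x z) argo
  ultimately show ?thesis
    unfolding gap_gain b_def[symmetric] s_def[symmetric] by linarith
qed

text \<open>In other words, the generator maps \<open>lyap\<close> to at most
  \<open>- rate * lyap\<close>. Averaging the cross terms of the jumps produces the projected inner
  product of \<open>x\<close> and \<open>z\<close>, which cancels the one in \<open>drift\<close>.
  The remaining mixed term in \<open>pinv\<close> is split using positivity at \<open>x - z\<close>,
  and its \<open>x\<close> part is controlled by \<open>pinv_le\<close>.\<close>

lemma mean_lyap_jump_le: "(\<Sum>e\<in>E. pmf P e * lyap (jump e \<xi>)) \<le> (1 - rate) * lyap \<xi> - drift \<xi>"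
proof -
  let ?x = "fst \<xi>" and ?z = "snd \<xi>"
  have "(\<Sum>e\<in>E. pmf P e * lyap (jump e \<xi>))
      \<le> (\<Sum>e\<in>E. pmf P e * (lyap \<xi> - rate * ((edge_vec e \<bullet> ?x) * (edge_vec e \<bullet> (pinv *v ?z)))))"
    by (intro sum_mono mult_left_mono lyap_jump_le) simp_all
  also have "\<dots> = (\<Sum>e\<in>E. pmf P e) * lyap \<xi> - rate * ((pinv *v ?z) \<bullet> (Lap *v ?x))"
    by (simp add: inner_laplacian right_diff_distrib sum_subtractf sum_distrib_left
        sum_distrib_right mult_ac)
  also have "(\<Sum>e\<in>E. pmf P e) = 1" using support by (intro sum_pmf_eq_1) auto
  also have "(pinv *v ?z) \<bullet> (Lap *v ?x) = centre ?x \<bullet> centre ?z"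
    by (subst inner_laplacian_commute) (simp add: laplacian_pinv_mult centre_inner_centre)
  finally have *: "(\<Sum>e\<in>E. pmf P e * lyap (jump e \<xi>)) \<le> lyap \<xi> - rate * (centre ?x \<bullet> centre ?z)"
    by simp
  have "0 \<le> (?x - ?z) \<bullet> (pinv *v (?x - ?z))" by (rule pinv_nonneg)
  then have "2 * (?z \<bullet> (pinv *v ?x)) \<le> ?x \<bullet> (pinv *v ?x) + ?z \<bullet> (pinv *v ?z)"
    by (simp add: matrix_vector_mult_diff_distrib inner_diff_left inner_diff_right
        inner_pinv_commute[of ?x ?z])
  then have "gap * (2 * (?z \<bullet> (pinv *v ?x))) \<le> gap * (?x \<bullet> (pinv *v ?x) + ?z \<bullet> (pinv *v ?z))"
    using gap_pos by simp
  then have "2 * gap * (?z \<bullet> (pinv *v ?x)) \<le> centre ?x \<bullet> centre ?x + gap * (?z \<bullet> (pinv *v ?z))"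
    using pinv_le[of ?x] by (simp add: distrib_left)
  then have "rate * (2 * gap * (?z \<bullet> (pinv *v ?x)))
      \<le> rate * (centre ?x \<bullet> centre ?x + gap * (?z \<bullet> (pinv *v ?z)))"
    using rate_pos by simp
  moreover have "rate * lyap \<xi> + drift \<xi> = rate * (centre ?x \<bullet> centre ?z)
      - 1/2 * (rate * (centre ?x \<bullet> centre ?x + gap * (?z \<bullet> (pinv *v ?z))))
      + 1/2 * (rate * (2 * gap * (?z \<bullet> (pinv *v ?x))))"
    unfolding lyap_def drift_def centre_diff inner_diff_right matrix_vector_mult_diff_distrib
    by argo
  ultimately have "rate * lyap \<xi> + drift \<xi> \<le> rate * (centre ?x \<bullet> centre ?z)" by linarith
  moreover have "(1 - rate) * lyap \<xi> = lyap \<xi> - rate * lyap \<xi>" by (simp add: left_diff_distrib)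
  ultimately show ?thesis using * by linarith
qed

text \<open>In terms of the half-sum \<open>p\<close> and half-difference \<open>q\<close>, the flow
  only multiplies \<open>q\<close> by \<open>u s\<close>, so \<open>lyap\<close> becomes a quadratic
  polynomial in \<open>u s\<close>.\<close>

lemma lyap_flow_derivative:
  "((\<lambda>s. lyap (flow s \<xi>)) has_real_derivative drift (flow s \<xi>)) (at s)"
proof -
  define p q where "p = (1/2) *\<^sub>R (fst \<xi> + snd \<xi>)" and "q = (1/2) *\<^sub>R (fst \<xi> - snd \<xi>)"
  define u where "u s = exp (- 2 * rate * s)" for s
  have flow: "flow s \<xi> = (p + u s *\<^sub>R q, p - u s *\<^sub>R q)" for s
    by (simp add: flow_def p_def q_def u_def)
  have lyap: "lyap (flow s \<xi>) = 1/2 * (centre p \<bullet> centre p + 2 * u s * (centre p \<bullet> centre q)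
      + (u s)\<^sup>2 * (centre q \<bullet> centre q))
      + gap/2 * (p \<bullet> (pinv *v p) - 2 * u s * (p \<bullet> (pinv *v q)) + (u s)\<^sup>2 * (q \<bullet> (pinv *v q)))" for s
    by (simp add: flow lyap_def centre_add centre_scaleR inner_add_left inner_add_right
        inner_diff_left inner_diff_right matrix_vector_mult_diff_distrib matrix_vector_mult_scaleR
        inner_commute[of "centre q" "centre p"] inner_pinv_commute[of q p] power2_eq_square
        algebra_simps)
  have drift: "drift (flow s \<xi>) = rate * (- 2 * u s * (centre p \<bullet> centre q)
      - 2 * (u s)\<^sup>2 * (centre q \<bullet> centre q))
      + gap * rate * (2 * u s * (p \<bullet> (pinv *v q)) - 2 * (u s)\<^sup>2 * (q \<bullet> (pinv *v q)))" for s
  proof -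
    have "p - u s *\<^sub>R q - (p + u s *\<^sub>R q) = (- 2 * u s) *\<^sub>R q"
      "p + u s *\<^sub>R q - (p - u s *\<^sub>R q) = (2 * u s) *\<^sub>R q"
      by (simp_all add: algebra_simps flip: scaleR_2)
    then have "centre (p - u s *\<^sub>R q - (p + u s *\<^sub>R q)) = (- 2 * u s) *\<^sub>R centre q"
      "pinv *v (p + u s *\<^sub>R q - (p - u s *\<^sub>R q)) = (2 * u s) *\<^sub>R (pinv *v q)"
      by (simp_all only: centre_scaleR matrix_vector_mult_scaleR)
    then show ?thesis
      unfolding flow drift_def fst_conv snd_conv
      by (simp add: centre_add centre_scaleR inner_add_left inner_diff_left power2_eq_square)
        (simp add: algebra_simps)
  qed
  have "(u has_real_derivative - 2 * rate * u s) (at s)"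
    unfolding u_def by (auto intro!: derivative_eq_intros)
  then show ?thesis
    unfolding lyap drift
    by (auto intro!: derivative_eq_intros simp: power2_eq_square algebra_simps)
qed

section \<open>Continuity of the maps and integration over one edge\<close>

lemma continuous_centre [continuous_intros]:
  "continuous_on S f \<Longrightarrow> continuous_on S (\<lambda>x. centre (f x :: real^'v))"
  unfolding centre_def by (intro continuous_intros) auto

lemma continuous_pinv [continuous_intros]:
  "continuous_on S f \<Longrightarrow> continuous_on S (\<lambda>x. pinv *v (f x :: real^'v))"
  by (rule continuous_on_compose2[OF matrix_vector_mult_linear_continuous_on[of UNIV pinv]]) auto

lemma continuous_flow [continuous_intros]:
  "continuous_on S f \<Longrightarrow> continuous_on S g \<Longrightarrow> continuous_on S (\<lambda>x. flow (f x) (g x))"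
  unfolding flow_def by (intro continuous_intros) auto

lemma continuous_lyap [continuous_intros]:
  "continuous_on S f \<Longrightarrow> continuous_on S (\<lambda>x. lyap (f x))"
  unfolding lyap_def by (intro continuous_intros) auto

lemma continuous_drift [continuous_intros]:
  "continuous_on S f \<Longrightarrow> continuous_on S (\<lambda>x. drift (f x))"
  unfolding drift_def by (intro continuous_intros) auto

lemma continuous_jump [continuous_intros]:
  "continuous_on S f \<Longrightarrow> continuous_on S (\<lambda>x. jump e (f x))"
  unfolding jump_def by (intro continuous_intros) auto

lemma nn_integral_edges:
  "(\<integral>\<^sup>+ e. f e \<partial>measure_pmf P) = (\<Sum>e\<in>E. ennreal (pmf P e) * f e)"
  by (subst nn_integral_measure_pmf_support[of E]) (auto simp: support mult.commute)

abbreviation expo :: "real measure" where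
  "expo \<equiv> density lborel (\<lambda>s. ennreal (exponential_density 1 s))"

text \<open>The Lyapunov inequality makes the integrand over \<open>s \<le> r\<close> at most the derivative of
  \<open>- exp ((rate - 1) * s) * lyap (flow s \<xi>)\<close>, whose boundary term at \<open>r\<close> is exactly compensated
  by the event that the waiting time exceeds \<open>r\<close>.\<close>

lemma one_step:
  assumes "r \<ge> 0" and C: "C \<ge> 0"
  shows "(\<integral>\<^sup>+ s. (if r < s then ennreal (C * (exp (rate * r) * lyap (flow r \<xi>)))
          else \<Sum>e\<in>E. ennreal (pmf P e) * ennreal (C * (exp (rate * s) * lyap (jump e (flow s \<xi>)))))
       \<partial>expo) \<le> ennreal (C * lyap \<xi>)"
proof -
  \<comment> \<open>\<open>C\<close> stands for the exponential factor accumulated up to the last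
    activation; \<open>K\<close> is the value reached when no activation occurs within time
    \<open>r\<close>.\<close>
  define K where "K = C * (exp (rate * r) * lyap (flow r \<xi>))"
  define g where "g s = C * lyap (flow s \<xi>)" for s
  define F where "F s = exp ((rate - 1) * s) * ((1 - rate) * g s - C * drift (flow s \<xi>))" for s
  define H where "H s = (\<Sum>e\<in>E. pmf P e * (C * (exp (rate * s) * lyap (jump e (flow s \<xi>)))))" for s
  have K: "K \<ge> 0" using C by (simp add: K_def lyap_nonneg)
  have H: "(\<Sum>e\<in>E. ennreal (pmf P e) * ennreal (C * (exp (rate * s) * lyap (jump e (flow s \<xi>))))) = ennreal (H s)" for s
    using C by (simp add: H_def lyap_nonneg flip: sum_ennreal ennreal_mult)
  have Hnn: "H s \<ge> 0" for s unfolding H_def using C by (intro sum_nonneg) (simp add: lyap_nonneg)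
  have HF: "exp (- s) * H s \<le> F s" for s
  proof -
    have "exp (- s) * H s = exp ((rate - 1) * s) * C * (\<Sum>e\<in>E. pmf P e * lyap (jump e (flow s \<xi>)))"
      by (simp add: H_def sum_distrib_left mult.left_commute left_diff_distrib exp_diff exp_minus field_simps)
    also have "\<dots> \<le> exp ((rate - 1) * s) * C * ((1 - rate) * lyap (flow s \<xi>) - drift (flow s \<xi>))"
      using C by (intro mult_left_mono mean_lyap_jump_le) simp
    also have "\<dots> = F s"
      unfolding F_def g_def by (simp add: algebra_simps)
    finally show ?thesis .
  qed
  \<comment> \<open>The sign of \<open>F\<close> is not visible from its formula; it is inherited
    from the nonnegative mean \<open>H\<close> that it dominates.\<close>
  have Fnn: "F s \<ge> 0" for s using HF[of s] Hnn[of s] by (meson exp_ge_zero mult_nonneg_nonneg order_trans)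
  have contF: "continuous_on UNIV F" unfolding F_def g_def by (intro continuous_intros)
  then have Fmeas: "F \<in> borel_measurable borel" by (rule borel_measurable_continuous_onI)
  have contH: "continuous_on UNIV H" unfolding H_def by (intro continuous_intros)
  then have [measurable]: "H \<in> borel_measurable borel" by (rule borel_measurable_continuous_onI)
  have FTC: "(\<integral>\<^sup>+ s. ennreal (F s) * indicator {0..r} s \<partial>lborel)
      = ennreal (- exp ((rate - 1) * r) * g r - (- exp ((rate - 1) * 0) * g 0))"
  proof (rule nn_integral_FTC_Icc[OF Fmeas])
    fix s
    have "((\<lambda>s. lyap (flow s \<xi>)) has_real_derivative drift (flow s \<xi>)) (at s)"
      by (rule lyap_flow_derivative)
    then show "((\<lambda>s. - exp ((rate - 1) * s) * g s) has_real_derivative F s) (at s)"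
      unfolding g_def F_def by (auto intro!: derivative_eq_intros simp: algebra_simps)
  qed (use assms Fnn in auto)
  have "(\<integral>\<^sup>+ s. (if r < s then ennreal K
          else \<Sum>e\<in>E. ennreal (pmf P e) * ennreal (C * (exp (rate * s) * lyap (jump e (flow s \<xi>)))))
       \<partial>expo)
     = (\<integral>\<^sup>+ s. ennreal (exponential_density 1 s) * (if r < s then ennreal K else ennreal (H s)) \<partial>lborel)"
    unfolding H by (rule nn_integral_density) measurable
  \<comment> \<open>The point \<open>s = r\<close> is counted in both indicators, which is harmless
    for an upper bound.\<close>
  also have "\<dots> \<le> (\<integral>\<^sup>+ s. ennreal (K * exp (- s)) * indicator {r..} s + ennreal (F s) * indicator {0..r} s \<partial>lborel)"
  proof (rule nn_integral_mono)
    fix s :: real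
    show "ennreal (exponential_density 1 s) * (if r < s then ennreal K else ennreal (H s))
      \<le> ennreal (K * exp (- s)) * indicator {r..} s + ennreal (F s) * indicator {0..r} s"
    proof (cases "s < 0")
      case True
      then show ?thesis by (simp add: exponential_density_def)
    next
      case False
      then show ?thesis using HF[of s] K Hnn[of s] Fnn[of s] assms
        by (auto simp: exponential_density_def indicator_def mult.commute ennreal_leI add_increasing
            simp flip: ennreal_mult ennreal_plus)
    qed
  qed
  also have "\<dots> = ennreal (K * exp (- r)) + ennreal (- exp ((rate - 1) * r) * g r - (- exp ((rate - 1) * 0) * g 0))"
    using Fmeas using FTC by (subst nn_integral_add) (auto simp: exp_tail_nn_integral[OF K])
  also have "\<dots> = ennreal (K * exp (- r) + (- exp ((rate - 1) * r) * g r - (- exp ((rate - 1) * 0) * g 0)))"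
  proof (rule ennreal_plus[symmetric])
    \<comment> \<open>Merging sums under \<open>ennreal\<close> requires nonnegative reals; this
      increment is nonnegative as the integral of \<open>F\<close>.\<close>
    show "0 \<le> - exp ((rate - 1) * r) * g r - (- exp ((rate - 1) * 0) * g 0)"
    proof -
      have "((\<lambda>s. F s) has_integral (- exp ((rate - 1) * r) * g r - (- exp ((rate - 1) * 0) * g 0))) {0..r}"
      proof (rule fundamental_theorem_of_calculus[OF assms(1)])
        fix s
        have "((\<lambda>s. lyap (flow s \<xi>)) has_real_derivative drift (flow s \<xi>)) (at s within {0..r})"
          by (rule has_field_derivative_at_within[OF lyap_flow_derivative])
        then show "((\<lambda>s. - exp ((rate - 1) * s) * g s) has_vector_derivative F s) (at s within {0..r})"
          unfolding has_real_derivative_iff_has_vector_derivative[symmetric] g_def F_def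
          by (auto intro!: derivative_eq_intros simp: algebra_simps)
      qed
      then show ?thesis by (rule has_integral_nonneg) (rule Fnn)
    qed
  qed (use K in simp)
  also have "K * exp (- r) + (- exp ((rate - 1) * r) * g r - (- exp ((rate - 1) * 0) * g 0)) = C * lyap \<xi>"
    by (simp add: K_def g_def flow_0 left_diff_distrib exp_diff exp_minus field_simps)
  finally show ?thesis unfolding K_def .
qed

end

section \<open>The embedded jump chain\<close>

text \<open>Waiting times are counted from \<open>0\<close>, so \<open>clock (Suc k)\<close> is the activation time \<open>T k\<close>.\<close>

definition clock :: "nat \<Rightarrow> (nat \<Rightarrow> real) \<Rightarrow> real" where
  "clock k a = (\<Sum>i<k. a i)"

lemma clock_0 [simp]: "clock 0 a = 0"
  and clock_Suc [simp]: "clock (Suc k) a = clock k a + a k"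
  by (simp_all add: clock_def)

lemma clock_cong: "(\<And>i. i < k \<Longrightarrow> a i = a' i) \<Longrightarrow> clock k a = clock k a'"
  by (simp add: clock_def)

lemma measurable_clock:
  "(\<And>i. i < k \<Longrightarrow> (\<lambda>\<omega>. A \<omega> i) \<in> borel_measurable N) \<Longrightarrow> (\<lambda>\<omega>. clock k (A \<omega>)) \<in> borel_measurable N"
  unfolding clock_def by (intro borel_measurable_sum) simp

context gossip_graph
begin

text \<open>The pair \<open>(x, z)\<close> just after the first \<open>k\<close> activations, for
  waiting times \<open>a\<close> and edges \<open>b\<close>, with both components started at
  \<open>y\<close>.\<close>

primrec state :: "real^'v \<Rightarrow> nat \<Rightarrow> (nat \<Rightarrow> real) \<Rightarrow> (nat \<Rightarrow> 'v set) \<Rightarrow> (real^'v) \<times> (real^'v)" where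
  "state y 0 a b = (y, y)"
| "state y (Suc k) a b = jump (b k) (flow (a k) (state y k a b))"

lemma state_cong:
  "(\<And>i. i < k \<Longrightarrow> a i = a' i) \<Longrightarrow> (\<And>i. i < k \<Longrightarrow> b i = b' i) \<Longrightarrow> state y k a b = state y k a' b'"
  by (induction k) simp_all

section \<open>Measurability along the chain\<close>

lemma measurable_flow:
  assumes "f \<in> borel_measurable N" "g \<in> borel_measurable N"
  shows "(\<lambda>\<omega>. flow (f \<omega>) (g \<omega>)) \<in> borel_measurable N"
  using assms by (rule borel_measurable_continuous_Pair) (intro continuous_intros)

lemma measurable_lyap:
  assumes "g \<in> borel_measurable N"
  shows "(\<lambda>\<omega>. lyap (g \<omega>)) \<in> borel_measurable N"
  by (rule borel_measurable_continuous_on[OF _ assms]) (intro continuous_intros)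

lemma measurable_jump:
  assumes "g \<in> borel_measurable N"
  shows "(\<lambda>\<omega>. jump e (g \<omega>)) \<in> borel_measurable N"
  by (rule borel_measurable_continuous_on[OF _ assms]) (intro continuous_intros)

text \<open>The map applied at a jump is itself random; measurability follows by splitting over the
  finitely many possible edges.\<close>

lemma measurable_state:
  assumes "\<And>i. i < k \<Longrightarrow> (\<lambda>\<omega>. A \<omega> i) \<in> borel_measurable N"
    and "\<And>i. i < k \<Longrightarrow> (\<lambda>\<omega>. B \<omega> i) \<in> N \<rightarrow>\<^sub>M count_space UNIV"
  shows "(\<lambda>\<omega>. state y k (A \<omega>) (B \<omega>)) \<in> borel_measurable N"
  using assms
proof (induction k)
  case (Suc k)
  let ?J = "\<lambda>e \<omega>. jump e (flow (A \<omega> k) (state y k (A \<omega>) (B \<omega>)))"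
  have "?J e \<in> borel_measurable N" for e
    using Suc by (intro measurable_jump measurable_flow) auto
  moreover have "(\<lambda>\<omega>. B \<omega> k) \<in> N \<rightarrow>\<^sub>M count_space UNIV" using Suc by simp
  moreover have "countable (UNIV :: 'v set set)" by (simp add: countable_finite)
  ultimately have "(\<lambda>\<omega>. ?J (B \<omega> k) \<omega>) \<in> borel_measurable N"
    by (rule measurable_compose_countable'[where I = UNIV])
  then show ?case by simp
qed simp

text \<open>The random variables with means W_k in the outline; those of \<open>sojourn\<close> have
  means A_k.\<close>

definition weight :: "real^'v \<Rightarrow> real \<Rightarrow> nat \<Rightarrow> (nat \<Rightarrow> real) \<Rightarrow> (nat \<Rightarrow> 'v set) \<Rightarrow> real" where
  "weight y t k a b = (if clock k a \<le> t then exp (rate * clock k a) * lyap (state y k a b) else 0)"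

definition sojourn :: "real^'v \<Rightarrow> real \<Rightarrow> nat \<Rightarrow> (nat \<Rightarrow> real) \<Rightarrow> (nat \<Rightarrow> 'v set) \<Rightarrow> real" where
  "sojourn y t k a b = (if clock k a \<le> t \<and> t < clock (Suc k) a
     then exp (rate * t) * lyap (flow (t - clock k a) (state y k a b)) else 0)"

text \<open>The next waiting time decides whether \<open>t\<close> falls in the interval, but the
  next edge does not enter, whence \<open>k + 1\<close> waiting times and only \<open>k\<close>
  edges.\<close>

lemma sojourn_cong:
  "(\<And>i. i < Suc k \<Longrightarrow> a i = a' i) \<Longrightarrow> (\<And>i. i < k \<Longrightarrow> b i = b' i)
    \<Longrightarrow> sojourn y t k a b = sojourn y t k a' b'"
  unfolding sojourn_def
  using clock_cong[of k a a'] clock_cong[of "Suc k" a a'] state_cong[of k a a' b b'] by simp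

lemma measurable_weight:
  assumes "\<And>i. i < k \<Longrightarrow> (\<lambda>\<omega>. A \<omega> i) \<in> borel_measurable N"
    and "\<And>i. i < k \<Longrightarrow> (\<lambda>\<omega>. B \<omega> i) \<in> N \<rightarrow>\<^sub>M count_space UNIV"
  shows "(\<lambda>\<omega>. weight y t k (A \<omega>) (B \<omega>)) \<in> borel_measurable N"
proof -
  have [measurable]: "(\<lambda>\<omega>. clock k (A \<omega>)) \<in> borel_measurable N"
    using assms by (intro measurable_clock) auto
  have [measurable]: "(\<lambda>\<omega>. lyap (state y k (A \<omega>) (B \<omega>))) \<in> borel_measurable N"
    using assms by (intro measurable_lyap measurable_state) auto
  show ?thesis unfolding weight_def by measurable
qed

lemma measurable_sojourn:
  assumes "\<And>i. i < Suc k \<Longrightarrow> (\<lambda>\<omega>. A \<omega> i) \<in> borel_measurable N"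
    and "\<And>i. i < k \<Longrightarrow> (\<lambda>\<omega>. B \<omega> i) \<in> N \<rightarrow>\<^sub>M count_space UNIV"
  shows "(\<lambda>\<omega>. sojourn y t k (A \<omega>) (B \<omega>)) \<in> borel_measurable N"
proof -
  have [measurable]: "(\<lambda>\<omega>. clock k (A \<omega>)) \<in> borel_measurable N" "(\<lambda>\<omega>. clock (Suc k) (A \<omega>)) \<in> borel_measurable N"
    using assms by (intro measurable_clock; auto)+
  have [measurable]: "(\<lambda>\<omega>. lyap (flow (t - clock k (A \<omega>)) (state y k (A \<omega>) (B \<omega>)))) \<in> borel_measurable N"
    using assms by (intro measurable_lyap measurable_flow measurable_state) auto
  show ?thesis unfolding sojourn_def by measurable
qed

section \<open>The product laws of finitely many waiting times and edges\<close>

abbreviation noise :: "nat \<Rightarrow> (nat \<Rightarrow> real) measure" where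
  "noise k \<equiv> Pi\<^sub>M {..<k} (\<lambda>_. expo)"

abbreviation marks :: "nat \<Rightarrow> (nat \<Rightarrow> 'v set) measure" where
  "marks k \<equiv> Pi\<^sub>M {..<k} (\<lambda>_. measure_pmf P)"

lemma prob_space_expo: "prob_space expo"
  by (rule prob_space_exponential_density) simp

lemma prob_space_noise: "prob_space (noise k)"
  and prob_space_marks: "prob_space (marks k)"
  by (auto intro!: prob_space_PiM prob_space_expo prob_space_measure_pmf)

text \<open>The last edge and the last waiting time are split off in turn. The product is exchanged
  before and after the second splitting so that both new variables end up innermost.\<close>

lemma nn_integral_extend:
  assumes f: "f \<in> borel_measurable (noise (Suc k) \<Otimes>\<^sub>M marks (Suc k))"
  shows "(\<integral>\<^sup>+ \<omega>. f \<omega> \<partial>(noise (Suc k) \<Otimes>\<^sub>M marks (Suc k)))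
    = (\<integral>\<^sup>+ a. \<integral>\<^sup>+ b. \<integral>\<^sup>+ s. (\<Sum>e\<in>E. ennreal (pmf P e) * f (a(k := s), b(k := e)))
        \<partial>expo \<partial>marks k \<partial>noise k)"
proof -
  interpret N: product_sigma_finite "\<lambda>_::nat. expo"
    by (simp add: product_sigma_finite_def prob_space_expo prob_space_imp_sigma_finite)
  interpret E: product_sigma_finite "\<lambda>_::nat. measure_pmf P"
    by (simp add: product_sigma_finite_def prob_space_measure_pmf prob_space_imp_sigma_finite)
  interpret n: prob_space "noise k" by (rule prob_space_noise)
  interpret n': prob_space "noise (Suc k)" by (rule prob_space_noise)
  interpret m: prob_space "marks k" by (rule prob_space_marks)
  interpret m': prob_space "marks (Suc k)" by (rule prob_space_marks)
  interpret pair_sigma_finite "noise (Suc k)" "marks k" ..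
  interpret p: pair_sigma_finite "noise k" "marks k" ..
  define G where "G a b = (\<Sum>e\<in>E. ennreal (pmf P e) * f (a, b(k := e)))" for a b
  have upd: "(\<lambda>x. (snd x)(k := e)) \<in> noise (Suc k) \<Otimes>\<^sub>M marks k \<rightarrow>\<^sub>M marks (Suc k)" for e
    by (rule measurable_fun_upd[where J = "{..<k}"]) (auto simp: lessThan_Suc)
  have [measurable]: "(\<lambda>x. f (fst x, (snd x)(k := e))) \<in> borel_measurable (noise (Suc k) \<Otimes>\<^sub>M marks k)" for e
    by (rule measurable_compose[OF _ f]) (intro measurable_Pair upd measurable_fst)
  have G: "(\<lambda>x. G (fst x) (snd x)) \<in> borel_measurable (noise (Suc k) \<Otimes>\<^sub>M marks k)"
    unfolding G_def by measurable
  have "(\<integral>\<^sup>+ \<omega>. f \<omega> \<partial>(noise (Suc k) \<Otimes>\<^sub>M marks (Suc k)))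
      = (\<integral>\<^sup>+ a. \<integral>\<^sup>+ b. f (a, b) \<partial>marks (Suc k) \<partial>noise (Suc k))"
    by (rule m'.nn_integral_fst[OF f, symmetric])
  also have "\<dots> = (\<integral>\<^sup>+ a. \<integral>\<^sup>+ b. G a b \<partial>marks k \<partial>noise (Suc k))"
  proof (rule nn_integral_cong)
    fix a assume a: "a \<in> space (noise (Suc k))"
    have "(\<integral>\<^sup>+ b. f (a, b) \<partial>marks (Suc k)) = (\<integral>\<^sup>+ b. \<integral>\<^sup>+ e. f (a, b(k := e)) \<partial>measure_pmf P \<partial>marks k)"
      unfolding lessThan_Suc
      by (rule E.product_nn_integral_insert)
        (use a measurable_Pair2[OF f a] in \<open>auto simp: lessThan_Suc\<close>)
    then show "(\<integral>\<^sup>+ b. f (a, b) \<partial>marks (Suc k)) = (\<integral>\<^sup>+ b. G a b \<partial>marks k)"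
      by (simp add: nn_integral_edges G_def)
  qed
  also have "\<dots> = (\<integral>\<^sup>+ b. \<integral>\<^sup>+ a. G a b \<partial>noise (Suc k) \<partial>marks k)"
    by (rule Fubini'[symmetric]) (use G in \<open>simp add: case_prod_unfold\<close>)
  also have "\<dots> = (\<integral>\<^sup>+ b. \<integral>\<^sup>+ a. \<integral>\<^sup>+ s. G (a(k := s)) b \<partial>expo \<partial>noise k \<partial>marks k)"
  proof (rule nn_integral_cong)
    fix b assume b: "b \<in> space (marks k)"
    have "(\<lambda>a. G a b) \<in> borel_measurable (noise (Suc k))"
      using measurable_Pair1[OF G b] by simp
    then show "(\<integral>\<^sup>+ a. G a b \<partial>noise (Suc k)) = (\<integral>\<^sup>+ a. \<integral>\<^sup>+ s. G (a(k := s)) b \<partial>expo \<partial>noise k)"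
      unfolding lessThan_Suc by (intro N.product_nn_integral_insert) auto
  qed
  also have "\<dots> = (\<integral>\<^sup>+ a. \<integral>\<^sup>+ b. \<integral>\<^sup>+ s. G (a(k := s)) b \<partial>expo \<partial>marks k \<partial>noise k)"
  proof (rule p.Fubini')
    have "(\<lambda>x. ((fst (fst x))(k := snd x), snd (fst x)))
        \<in> (noise k \<Otimes>\<^sub>M marks k) \<Otimes>\<^sub>M expo \<rightarrow>\<^sub>M noise (Suc k) \<Otimes>\<^sub>M marks k"
      by (intro measurable_Pair measurable_fun_upd[where J = "{..<k}"])
        (auto simp: lessThan_Suc measurable_compose[OF measurable_fst])
    from measurable_compose[OF this G]
    have "(\<lambda>x. G ((fst (fst x))(k := snd x)) (snd (fst x))) \<in> borel_measurable ((noise k \<Otimes>\<^sub>M marks k) \<Otimes>\<^sub>M expo)"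
      by simp
    then show "(\<lambda>(a, b). \<integral>\<^sup>+ s. G (a(k := s)) b \<partial>expo) \<in> borel_measurable (noise k \<Otimes>\<^sub>M marks k)"
      by (simp add: case_prod_unfold
          sigma_finite_measure.borel_measurable_nn_integral[OF prob_space_imp_sigma_finite[OF prob_space_expo]])
  qed
  finally show ?thesis unfolding G_def .
qed

lemma component_noise: "i < k \<Longrightarrow> (\<lambda>\<omega>. fst \<omega> i) \<in> borel_measurable (noise k \<Otimes>\<^sub>M marks k)"
proof -
  assume "i < k"
  then have "(\<lambda>a. a i) \<in> noise k \<rightarrow>\<^sub>M expo" by (intro measurable_component_singleton) simp
  then have "(\<lambda>a. a i) \<in> borel_measurable (noise k)" by simp
  then show ?thesis by (rule measurable_compose[OF measurable_fst])
qed

lemma component_marks: "i < k \<Longrightarrow> (\<lambda>\<omega>. snd \<omega> i) \<in> noise k \<Otimes>\<^sub>M marks k \<rightarrow>\<^sub>M count_space UNIV"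
proof -
  assume "i < k"
  then have "(\<lambda>a. a i) \<in> marks k \<rightarrow>\<^sub>M measure_pmf P" by (intro measurable_component_singleton) simp
  then have "(\<lambda>a. a i) \<in> marks k \<rightarrow>\<^sub>M count_space UNIV" by simp
  then show ?thesis by (rule measurable_compose[OF measurable_snd])
qed

text \<open>Conditionally on the first \<open>k\<close> steps, ending at time
  \<open>S \<le> t\<close>, the next waiting time either exceeds \<open>t - S\<close> and
  contributes to the sojourn, or contributes to the next weight. This is \<open>one_step\<close>
  with \<open>r = t - S\<close> and \<open>C = exp (rate * S)\<close>.\<close>

lemma sojourn_weight_step:
  "(\<integral>\<^sup>+ \<omega>. ennreal (sojourn y t k (fst \<omega>) (snd \<omega>)) \<partial>(noise (Suc k) \<Otimes>\<^sub>M marks (Suc k)))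
    + (\<integral>\<^sup>+ \<omega>. ennreal (weight y t (Suc k) (fst \<omega>) (snd \<omega>)) \<partial>(noise (Suc k) \<Otimes>\<^sub>M marks (Suc k)))
    \<le> (\<integral>\<^sup>+ \<omega>. ennreal (weight y t k (fst \<omega>) (snd \<omega>)) \<partial>(noise k \<Otimes>\<^sub>M marks k))"
  (is "?S + ?W \<le> ?V")
proof -
  interpret m: prob_space "marks k" by (rule prob_space_marks)
  let ?N = "noise (Suc k) \<Otimes>\<^sub>M marks (Suc k)"
  have S [measurable]: "(\<lambda>\<omega>. sojourn y t k (fst \<omega>) (snd \<omega>)) \<in> borel_measurable ?N"
    by (intro measurable_sojourn component_noise component_marks) auto
  have W [measurable]: "(\<lambda>\<omega>. weight y t (Suc k) (fst \<omega>) (snd \<omega>)) \<in> borel_measurable ?N"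
    by (intro measurable_weight component_noise component_marks) auto
  have W' [measurable]: "(\<lambda>\<omega>. weight y t k (fst \<omega>) (snd \<omega>)) \<in> borel_measurable (noise k \<Otimes>\<^sub>M marks k)"
    by (intro measurable_weight component_noise component_marks) auto
  let ?f = "\<lambda>\<omega>. ennreal (sojourn y t k (fst \<omega>) (snd \<omega>)) + ennreal (weight y t (Suc k) (fst \<omega>) (snd \<omega>))"
  \<comment> \<open>Once the clock has passed \<open>t\<close>, both terms vanish only because it
    cannot run backwards.\<close>
  have pos: "AE s in expo. 0 \<le> s"
    by (subst AE_density) (auto simp: exponential_density_def intro!: AE_I2)
  have inner: "(\<integral>\<^sup>+ s. (\<Sum>e\<in>E. ennreal (pmf P e) * ?f (a(k := s), b(k := e))) \<partial>expo)
      \<le> ennreal (weight y t k a b)" for a b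
  proof -
    define S \<xi> where "S = clock k a" and "\<xi> = state y k a b"
    have clock: "clock k (a(k := s)) = S" for s
      unfolding S_def by (rule clock_cong) simp
    have state: "state y k (a(k := s)) (b(k := e)) = \<xi>" for s e
      unfolding \<xi>_def by (rule state_cong) auto
    show ?thesis
    proof (cases "S \<le> t")
      case False
      then have "?f (a(k := s), b(k := e)) = 0" if "s \<ge> 0" for s e
        using that by (simp add: sojourn_def weight_def clock)
      then have "AE s in expo. (\<Sum>e\<in>E. ennreal (pmf P e) * ?f (a(k := s), b(k := e))) = 0"
        using pos by (auto elim!: eventually_mono)
      then have "(\<integral>\<^sup>+ s. (\<Sum>e\<in>E. ennreal (pmf P e) * ?f (a(k := s), b(k := e))) \<partial>expo)
          = (\<integral>\<^sup>+ s. 0 \<partial>expo)"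
        by (rule nn_integral_cong_AE)
      then show ?thesis by simp
    next
      case True
      have "(\<Sum>e\<in>E. ennreal (pmf P e) * ?f (a(k := s), b(k := e)))
          = (if t - S < s then ennreal (exp (rate * S) * (exp (rate * (t - S)) * lyap (flow (t - S) \<xi>)))
             else \<Sum>e\<in>E. ennreal (pmf P e) * ennreal (exp (rate * S) * (exp (rate * s) * lyap (jump e (flow s \<xi>)))))" for s
      proof (cases "t - S < s")
        case lt: True
        then have f: "?f (a(k := s), b(k := e)) = ennreal (exp (rate * t) * lyap (flow (t - S) \<xi>))" for e
          using True by (simp add: sojourn_def weight_def clock state)
        have "(\<Sum>e\<in>E. ennreal (pmf P e)) = 1"
          using sum_pmf_eq_1[of E P] support by (simp add: sum_ennreal)
        then have "(\<Sum>e\<in>E. ennreal (pmf P e) * ?f (a(k := s), b(k := e)))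
            = ennreal (exp (rate * t) * lyap (flow (t - S) \<xi>))"
          unfolding f by (simp flip: sum_distrib_right)
        moreover have "exp (rate * t) = exp (rate * S) * exp (rate * (t - S))"
          by (simp add: right_diff_distrib flip: exp_add)
        ultimately show ?thesis using lt by (simp add: mult.assoc)
      next
        case False
        then have "?f (a(k := s), b(k := e)) = ennreal (exp (rate * S) * (exp (rate * s) * lyap (jump e (flow s \<xi>))))" for e
          by (simp add: sojourn_def weight_def clock state distrib_left exp_add mult.assoc)
        then show ?thesis using False by simp
      qed
      then show ?thesis
        using one_step[of "t - S" "exp (rate * S)" \<xi>] True
        by (simp add: weight_def S_def \<xi>_def)
    qed
  qed
  have "?S + ?W = (\<integral>\<^sup>+ \<omega>. ?f \<omega> \<partial>?N)"
    by (rule nn_integral_add[symmetric]) measurable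
  also have "\<dots> = (\<integral>\<^sup>+ a. \<integral>\<^sup>+ b. \<integral>\<^sup>+ s. (\<Sum>e\<in>E. ennreal (pmf P e) * ?f (a(k := s), b(k := e)))
        \<partial>expo \<partial>marks k \<partial>noise k)"
    by (rule nn_integral_extend) measurable
  also have "\<dots> \<le> (\<integral>\<^sup>+ a. \<integral>\<^sup>+ b. ennreal (weight y t k a b) \<partial>marks k \<partial>noise k)"
    by (intro nn_integral_mono inner)
  also have "\<dots> = ?V"
    using W' by (subst m.nn_integral_fst[symmetric]) auto
  finally show ?thesis .
qed

text \<open>Telescoping of the one-step inequality; the weight is kept on the left so that the
  induction closes.\<close>

lemma sum_sojourn_le:
  assumes "t \<ge> 0"
  shows "(\<Sum>k<n. \<integral>\<^sup>+ \<omega>. ennreal (sojourn y t k (fst \<omega>) (snd \<omega>)) \<partial>(noise (Suc k) \<Otimes>\<^sub>M marks (Suc k)))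
    + (\<integral>\<^sup>+ \<omega>. ennreal (weight y t n (fst \<omega>) (snd \<omega>)) \<partial>(noise n \<Otimes>\<^sub>M marks n)) \<le> ennreal (lyap (y, y))"
proof (induction n)
  case 0
  interpret pair_prob_space "noise 0" "marks 0"
    by (simp add: pair_prob_space_def pair_sigma_finite_def prob_space_imp_sigma_finite
        prob_space_noise prob_space_marks del: lessThan_0)
  have "(\<integral>\<^sup>+ \<omega>. ennreal (weight y t 0 (fst \<omega>) (snd \<omega>)) \<partial>(noise 0 \<Otimes>\<^sub>M marks 0)) = ennreal (lyap (y, y))"
    using assms by (simp add: weight_def emeasure_space_1 del: lessThan_0)
  moreover have "(\<Sum>k<0. f k) = 0" for f :: "nat \<Rightarrow> ennreal" by simp
  ultimately show ?case by (simp only: add_0 order_refl)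
next
  case (Suc n)
  have "(\<Sum>k<Suc n. \<integral>\<^sup>+ \<omega>. ennreal (sojourn y t k (fst \<omega>) (snd \<omega>)) \<partial>(noise (Suc k) \<Otimes>\<^sub>M marks (Suc k)))
    + (\<integral>\<^sup>+ \<omega>. ennreal (weight y t (Suc n) (fst \<omega>) (snd \<omega>)) \<partial>(noise (Suc n) \<Otimes>\<^sub>M marks (Suc n)))
    \<le> (\<Sum>k<n. \<integral>\<^sup>+ \<omega>. ennreal (sojourn y t k (fst \<omega>) (snd \<omega>)) \<partial>(noise (Suc k) \<Otimes>\<^sub>M marks (Suc k)))
    + (\<integral>\<^sup>+ \<omega>. ennreal (weight y t n (fst \<omega>) (snd \<omega>)) \<partial>(noise n \<Otimes>\<^sub>M marks n))"
    unfolding sum.lessThan_Suc add.assoc by (intro add_left_mono sojourn_weight_step)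
  also note Suc
  finally show ?case .
qed

end

section \<open>Trajectories and the law of the activations\<close>

text \<open>The functions \<open>p\<close> and \<open>q\<close> have zero derivative in the interior
  and are continuous up to the ends, hence are constant. Derivatives are demanded only in the
  interior because a path may jump at \<open>c\<close>.\<close>

lemma relaxation_solution:
  fixes u w :: "real \<Rightarrow> real"
  assumes "c \<le> s"
    and cont: "continuous_on {c..s} u" "continuous_on {c..s} w"
    and u: "\<And>x. c < x \<Longrightarrow> x < s \<Longrightarrow> (u has_real_derivative r * (w x - u x)) (at x)"
    and w: "\<And>x. c < x \<Longrightarrow> x < s \<Longrightarrow> (w has_real_derivative r * (u x - w x)) (at x)"
  shows "u s = (u c + w c) / 2 + exp (- 2 * r * (s - c)) / 2 * (u c - w c)"
    and "w s = (u c + w c) / 2 - exp (- 2 * r * (s - c)) / 2 * (u c - w c)"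
proof -
  define p where "p x = u x + w x" for x
  define q where "q x = exp (2 * r * (x - c)) * (u x - w x)" for x
  have "p s = p c \<and> q s = q c"
  proof (cases "c = s")
    case False
    with \<open>c \<le> s\<close> have "c < s" by simp
    have "continuous_on {c..s} p" "continuous_on {c..s} q"
      unfolding p_def q_def by (intro continuous_intros cont)+
    moreover have "(p has_real_derivative 0) (at x)" if "c < x" "x < s" for x
      unfolding p_def using u[OF that] w[OF that]
      by (auto intro!: derivative_eq_intros simp: algebra_simps)
    moreover have "(q has_real_derivative 0) (at x)" if "c < x" "x < s" for x
      unfolding q_def using u[OF that] w[OF that]
      by (auto intro!: derivative_eq_intros simp: algebra_simps)
    ultimately show ?thesis using \<open>c < s\<close> by (simp add: DERIV_isconst_end)
  qed simp
  then have 1: "u s + w s = u c + w c" and 2: "exp (2 * r * (s - c)) * (u s - w s) = u c - w c"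
    by (simp_all add: p_def q_def)
  have "exp (- 2 * r * (s - c)) * (exp (2 * r * (s - c)) * (u s - w s)) = u s - w s"
    by (simp flip: mult.assoc exp_add)
  then have "u s - w s = exp (- 2 * r * (s - c)) * (u c - w c)" by (simp add: 2)
  with 1 show "u s = (u c + w c) / 2 + exp (- 2 * r * (s - c)) / 2 * (u c - w c)"
    and "w s = (u c + w c) / 2 - exp (- 2 * r * (s - c)) / 2 * (u c - w c)"
    by (simp_all add: field_simps)
qed

text \<open>At the left end, possibly an activation time, a path is only right-continuous; this
  suffices for continuity on the interval.\<close>

lemma continuous_on_Icc_right:
  fixes f :: "real \<Rightarrow> real"
  assumes "(f \<longlongrightarrow> f c) (at_right c)" "\<And>x. c < x \<Longrightarrow> x \<le> s \<Longrightarrow> isCont f x"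
  shows "continuous_on {c..s} f"
  unfolding continuous_on_eq_continuous_within
proof
  fix x assume x: "x \<in> {c..s}"
  show "continuous (at x within {c..s}) f"
  proof (cases "x = c")
    case True
    have "(f \<longlongrightarrow> f c) (at c within {c<..s})"
      by (rule tendsto_within_subset[OF assms(1)]) auto
    moreover have "at c within {c..s} = at c within {c<..s}"
      by (rule at_within_nhd[of c UNIV]) auto
    ultimately show ?thesis using True by (simp add: continuous_within)
  next
    case False
    then show ?thesis using assms(2)[of x] x by (simp add: continuous_at_imp_continuous_within)
  qed
qed

lemma clock_strict_mono: "(\<And>i. a i > 0) \<Longrightarrow> strict_mono (\<lambda>k. clock k a)"
  by (simp add: strict_mono_Suc_iff)

lemma clock_waiting_time: "clock (Suc k) (\<lambda>i. waiting_time T i \<omega>) = T k \<omega>"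
  by (induction k) (simp_all add: waiting_time_def)

context gossip_graph
begin

lemma tendsto_flow: "((\<lambda>s. flow (s - c) \<xi>) \<longlongrightarrow> flow (d - c) \<xi>) (at_left d)"
proof -
  have "continuous_on UNIV (\<lambda>s. flow (s - c) \<xi>)" by (intro continuous_intros)
  then have "isCont (\<lambda>s. flow (s - c) \<xi>) d" by (simp add: continuous_on_eq_continuous_at)
  then show ?thesis
    unfolding continuous_at by (rule filterlim_mono) (auto simp: at_le)
qed

lemma path_between_jumps:
  assumes path: "accelerated_gossip_path gap Rmax T b x z"
    and "0 \<le> c" "c \<le> s" "s < d" and gap_free: "\<And>k. T k \<le> c \<or> d \<le> T k"
  shows "(x s, z s) = flow (s - c) (x c, z c)"
proof -
  have right: "(x \<longlongrightarrow> x c) (at_right c)" "(z \<longlongrightarrow> z c) (at_right c)"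
    using path \<open>0 \<le> c\<close> by (auto simp: accelerated_gossip_path_def cadlag_def)
  have der: "((\<lambda>s. x s $ v) has_real_derivative rate * (z r $ v - x r $ v)) (at r)"
    "((\<lambda>s. z s $ v) has_real_derivative rate * (x r $ v - z r $ v)) (at r)" if "c < r" "r < d" for r v
  proof -
    have "r \<notin> range T" using gap_free that by (metis rangeE not_le)
    then show "((\<lambda>s. x s $ v) has_real_derivative rate * (z r $ v - x r $ v)) (at r)"
      "((\<lambda>s. z s $ v) has_real_derivative rate * (x r $ v - z r $ v)) (at r)"
      using path that \<open>0 \<le> c\<close> by (auto simp: accelerated_gossip_path_def rate_def)
  qed
  have cont: "continuous_on {c..s} (\<lambda>s. x s $ v)" "continuous_on {c..s} (\<lambda>s. z s $ v)" for v
    using der \<open>s < d\<close>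
    by (intro continuous_on_Icc_right tendsto_vec_nth right DERIV_isCont; force)+
  have "x s $ v = (x c $ v + z c $ v) / 2 + exp (- 2 * rate * (s - c)) / 2 * (x c $ v - z c $ v)"
    "z s $ v = (x c $ v + z c $ v) / 2 - exp (- 2 * rate * (s - c)) / 2 * (x c $ v - z c $ v)" for v
    using relaxation_solution[OF \<open>c \<le> s\<close> cont[of v], where r = rate] der \<open>s < d\<close> by simp_all
  then show ?thesis by (simp add: flow_def vec_eq_iff)
qed

text \<open>The left limits enter as hypotheses because \<open>left_limit\<close> is defined by
  \<open>Lim\<close> and can be evaluated only once convergence is known.\<close>

lemma path_jump:
  assumes path: "accelerated_gossip_path gap Rmax T b x z" and "b k \<in> E"
    and x: "(x \<longlongrightarrow> x') (at_left (T k))" and z: "(z \<longlongrightarrow> z') (at_left (T k))"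
  shows "(x (T k), z (T k)) = jump (b k) (x', z')"
proof -
  obtain v w where vw: "b k = {v, w}" "v \<noteq> w" and ev: "edge_vec (b k) = axis v 1 - axis w 1"
    using edge_vec_cases[OF card_edge[OF \<open>b k \<in> E\<close>]] by metis
  have "left_limit x (T k) = x'" "left_limit z (T k) = z'"
    unfolding left_limit_def using x z by (auto intro!: tendsto_Lim)
  then have J: "x (T k) $ v = (x' $ v + x' $ w) / 2" "x (T k) $ w = (x' $ v + x' $ w) / 2"
    "z (T k) $ v = z' $ v + gain * (x' $ w - x' $ v)" "z (T k) $ w = z' $ w + gain * (x' $ v - x' $ w)"
    "\<And>u. u \<noteq> v \<Longrightarrow> u \<noteq> w \<Longrightarrow> x (T k) $ u = x' $ u \<and> z (T k) $ u = z' $ u"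
    using path vw by (auto simp: accelerated_gossip_path_def gain_def Let_def)
  have b: "edge_vec (b k) \<bullet> x' = x' $ v - x' $ w"
    by (simp add: ev inner_diff_left inner_axis')
  have bv: "edge_vec (b k) $ v = 1" "edge_vec (b k) $ w = -1"
    "\<And>u. u \<noteq> v \<Longrightarrow> u \<noteq> w \<Longrightarrow> edge_vec (b k) $ u = 0"
    using vw(2) by (auto simp: ev axis_def)
  have "x (T k) $ u = (x' - ((edge_vec (b k) \<bullet> x') / 2) *\<^sub>R edge_vec (b k)) $ u \<and>
      z (T k) $ u = (z' - (gain * (edge_vec (b k) \<bullet> x')) *\<^sub>R edge_vec (b k)) $ u" for u
    by (cases "u = v"; cases "u = w") (simp_all add: J b bv field_simps)
  then show ?thesis by (simp add: jump_def vec_eq_iff)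
qed

text \<open>Induction over activations: the state at one activation fixes the path up to the next,
  the flow supplies the left limit there, and the jump rule gives the new state.\<close>

lemma path_eq_state:
  assumes path: "accelerated_gossip_path gap Rmax T b x z" and "x 0 = y" "z 0 = y"
    and a: "\<And>i. a i > 0" and T: "\<And>k. T k = clock (Suc k) a" and b: "\<And>k. b k \<in> E"
    and s: "clock k a \<le> s" "s < clock (Suc k) a"
  shows "(x s, z s) = flow (s - clock k a) (state y k a b)"
proof -
  have mono: "strict_mono (\<lambda>k. clock k a)" using a by (rule clock_strict_mono)
  have nonneg: "0 \<le> clock k a" for k
    unfolding clock_def by (rule sum_nonneg) (use a in \<open>simp add: less_imp_le\<close>)
  have gap_free: "T j \<le> clock k a \<or> clock (Suc k) a \<le> T j" for j k
    unfolding T strict_mono_less_eq[OF mono] by linarith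
  have flow: "(x s, z s) = flow (s - clock k a) (x (clock k a), z (clock k a))"
    if "clock k a \<le> s" "s < clock (Suc k) a" for s k
    using path_between_jumps[OF path nonneg that gap_free] .
  have "(x (clock k a), z (clock k a)) = state y k a b"
  proof (induction k)
    case 0
    then show ?case using assms by simp
  next
    case (Suc k)
    let ?F = "\<lambda>s. flow (s - clock k a) (state y k a b)"
    have lt: "clock k a < T k" using a T by simp
    have ev: "\<forall>\<^sub>F s in at_left (T k). (x s, z s) = ?F s"
      using eventually_at_left_real[OF lt]
      by eventually_elim (use flow[of k] Suc T in auto)
    have lim: "((\<lambda>s. (x s, z s)) \<longlongrightarrow> ?F (T k)) (at_left (T k))"
      by (rule Lim_transform_eventually[OF tendsto_flow]) (use ev in \<open>auto elim: eventually_mono\<close>)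
    have "(x \<longlongrightarrow> fst (?F (T k))) (at_left (T k))" "(z \<longlongrightarrow> snd (?F (T k))) (at_left (T k))"
      using tendsto_fst[OF lim] tendsto_snd[OF lim] by simp_all
    from path_jump[OF path b this] show ?case by (simp add: T)
  qed
  with flow[OF s] show ?thesis by simp
qed

section \<open>Conservation of the mean, and comparison of \<open>lyap\<close> with the
  deviation\<close>

lemma one_inner_flow:
  assumes "1 \<bullet> fst \<xi> = m" "1 \<bullet> snd \<xi> = m"
  shows "1 \<bullet> fst (flow s \<xi>) = m" "1 \<bullet> snd (flow s \<xi>) = m"
  using assms by (simp_all add: flow_def inner_add_right inner_diff_right)

text \<open>Jumps preserve the mean because edge vectors are mean-free. The flow mixes the two
  components, so their means are tracked together.\<close>

lemma one_inner_state:
  assumes "\<And>i. b i \<in> E"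
  shows "1 \<bullet> fst (state y k a b) = 1 \<bullet> y \<and> 1 \<bullet> snd (state y k a b) = 1 \<bullet> y"
proof (induction k)
  case (Suc k)
  then show ?case
    using one_inner_flow[of "state y k a b" "1 \<bullet> y" "a k"] one_inner_edge_vec[OF assms[of k]]
    by (simp add: jump_def inner_diff_right)
qed simp

lemma sum_square_deviation:
  assumes "1 \<bullet> x = real CARD('v) * m"
  shows "(\<Sum>v\<in>UNIV. (x $ v - m)\<^sup>2) = centre x \<bullet> centre (x :: real^'v)"
proof -
  have "(1 \<bullet> x) / real CARD('v) = m" using assms by simp
  then show ?thesis by (simp add: inner_vec_def centre_def power2_eq_square)
qed

text \<open>At equal components \<open>pinv_le\<close> bounds the \<open>z\<close> part by the
  \<open>x\<close> part; hence the factor 2 in the final estimate.\<close>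

lemma lyap_diagonal_le: "lyap (y, y) \<le> centre y \<bullet> centre y"
  using pinv_le[of y] by (simp add: lyap_def)

lemma half_centre_le_lyap: "1/2 * (centre (fst \<xi>) \<bullet> centre (fst \<xi>)) \<le> lyap \<xi>"
  using gap_pos pinv_nonneg[of "snd \<xi>"] by (simp add: lyap_def)

end

text \<open>The sum of \<open>k + 1\<close> waiting times has an Erlang law, so the probability that
  it is at most \<open>t\<close> is 1 minus \<open>exp (- t)\<close> times a partial sum of the
  exponential series, which tends to 0.\<close>

lemma nonexplosion:
  assumes "prob_space M"
    and exp: "\<And>k. distributed M lborel (X k) (exponential_density 1)"
    and ind: "prob_space.indep_vars M (\<lambda>_. borel) X UNIV" and "t \<ge> 0"
  shows "AE \<omega> in M. \<exists>k. t < clock (Suc k) (\<lambda>i. X i \<omega>)"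
proof -
  interpret prob_space M by fact
  have meas: "X i \<in> borel_measurable M" for i
    using distributed_measurable[OF exp[of i]] by simp
  have mc [measurable]: "(\<lambda>\<omega>. clock k (\<lambda>i. X i \<omega>)) \<in> borel_measurable M" for k
    by (intro measurable_clock meas)
  define N where "N = {\<omega> \<in> space M. \<forall>k. clock (Suc k) (\<lambda>i. X i \<omega>) \<le> t}"
  have N: "N \<in> sets M" unfolding N_def by measurable
  have le: "prob N \<le> 1 - (\<Sum>n\<le>k. t ^ n /\<^sub>R fact n) * exp (- t)" for k
  proof -
    have "distributed M lborel (\<lambda>\<omega>. \<Sum>i<Suc k. X i \<omega>) (erlang_density (card {..<Suc k} - 1) 1)"
      using exp ind by (intro exponential_distributed_sum) (auto intro: indep_vars_subset)
    then have "distributed M lborel (\<lambda>\<omega>. clock (Suc k) (\<lambda>i. X i \<omega>)) (erlang_density k 1)"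
      by (simp add: clock_def)
    moreover have "erlang_CDF k 1 t = 1 - (\<Sum>n\<le>k. t ^ n /\<^sub>R fact n) * exp (- t)"
      unfolding erlang_CDF_def sum_distrib_right using \<open>t \<ge> 0\<close> by (simp add: divide_inverse mult_ac)
    ultimately
    have "prob {\<omega> \<in> space M. clock (Suc k) (\<lambda>i. X i \<omega>) \<le> t} = 1 - (\<Sum>n\<le>k. t ^ n /\<^sub>R fact n) * exp (- t)"
      using erlang_distributed_le[of "\<lambda>\<omega>. clock (Suc k) (\<lambda>i. X i \<omega>)" k 1 t] \<open>t \<ge> 0\<close> by simp
    moreover have "prob N \<le> prob {\<omega> \<in> space M. clock (Suc k) (\<lambda>i. X i \<omega>) \<le> t}"
      by (rule finite_measure_mono) (auto simp: N_def simp del: clock_Suc)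
    ultimately show ?thesis by simp
  qed
  have "(\<lambda>k. \<Sum>n\<le>k. t ^ n /\<^sub>R fact n) \<longlonglongrightarrow> exp t"
    using exp_converges[of t] by (simp add: sums_def_le)
  then have "(\<lambda>k. 1 - (\<Sum>n\<le>k. t ^ n /\<^sub>R fact n) * exp (- t)) \<longlonglongrightarrow> 1 - exp t * exp (- t)"
    by (intro tendsto_intros)
  then have "prob N \<le> 1 - exp t * exp (- t)"
    by (rule LIMSEQ_le_const) (use le in auto)
  then have "prob N = 0" by (simp add: measure_le_0_iff flip: exp_add)
  then have "AE \<omega> in M. \<omega> \<notin> N" using N by (simp add: prob_eq_0)
  then show ?thesis by (rule AE_mp) (auto simp: N_def not_le simp del: clock_Suc intro!: AE_I2)
qed

context gossip_graph
begin

text \<open>Independence within each sequence identifies the two marginals as products; independence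
  of the two generated sigma-algebras then identifies the joint law on rectangles, which determine
  it.\<close>

lemma activation_law:
  fixes k :: nat
  assumes "prob_space M" and poisson: "poisson_edge_activations M P T e"
  defines "J \<equiv> {..<Suc k}"
  shows "(\<lambda>\<omega>. (\<lambda>i\<in>J. waiting_time T i \<omega>, \<lambda>i\<in>J. e i \<omega>)) \<in> M \<rightarrow>\<^sub>M noise (Suc k) \<Otimes>\<^sub>M marks (Suc k)" (is "?XY \<in> _")
    and "distr M (noise (Suc k) \<Otimes>\<^sub>M marks (Suc k)) (\<lambda>\<omega>. (\<lambda>i\<in>J. waiting_time T i \<omega>, \<lambda>i\<in>J. e i \<omega>))
      = noise (Suc k) \<Otimes>\<^sub>M marks (Suc k)"
proof -
  interpret prob_space M by fact
  let ?X = "\<lambda>\<omega>. \<lambda>i\<in>J. waiting_time T i \<omega>" and ?Y = "\<lambda>\<omega>. \<lambda>i\<in>J. e i \<omega>"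
  let ?X' = "\<lambda>\<omega> i. waiting_time T i \<omega>" and ?Y' = "\<lambda>\<omega> i. e i \<omega>"
  let ?VX = "vimage_algebra (space M) ?X' (Pi\<^sub>M UNIV (\<lambda>_. borel))"
  let ?VY = "vimage_algebra (space M) ?Y' (Pi\<^sub>M UNIV (\<lambda>_. count_space UNIV))"
  have dist: "distributed M lborel (waiting_time T i) (exponential_density 1)"
    and dist_e: "distr M (count_space UNIV) (e i) = measure_pmf P" for i
    using poisson by (auto simp: poisson_edge_activations_def)
  have ind: "indep_vars (\<lambda>_. borel) (waiting_time T) UNIV" "indep_vars (\<lambda>_. count_space UNIV) e UNIV"
    and ind2: "indep_set (sets ?VX) (sets ?VY)"
    using poisson by (auto simp: poisson_edge_activations_def)
  have mX: "waiting_time T i \<in> borel_measurable M" for i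
    using distributed_measurable[OF dist[of i]] by simp
  have mY: "e i \<in> M \<rightarrow>\<^sub>M count_space UNIV" for i
    using ind(2) by (auto simp: indep_vars_def)
  have sets_noise: "sets (noise (Suc k)) = sets (Pi\<^sub>M J (\<lambda>_. borel))"
    and sets_marks: "sets (marks (Suc k)) = sets (Pi\<^sub>M J (\<lambda>_. count_space UNIV))"
    unfolding J_def by (auto intro!: sets_PiM_cong)
  have mX': "?X \<in> M \<rightarrow>\<^sub>M Pi\<^sub>M J (\<lambda>_. borel)" and mY': "?Y \<in> M \<rightarrow>\<^sub>M Pi\<^sub>M J (\<lambda>_. count_space UNIV)"
    by (intro measurable_restrict mX mY)+
  have mXn: "?X \<in> M \<rightarrow>\<^sub>M noise (Suc k)" and mYn: "?Y \<in> M \<rightarrow>\<^sub>M marks (Suc k)"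
    using mX' mY' sets_noise sets_marks by (auto cong: measurable_cong_sets)
  then show XY: "?XY \<in> M \<rightarrow>\<^sub>M noise (Suc k) \<Otimes>\<^sub>M marks (Suc k)" by (rule measurable_Pair)
  have lawX: "distr M (noise (Suc k)) ?X = noise (Suc k)"
  proof -
    have "distr M (noise (Suc k)) ?X = distr M (Pi\<^sub>M J (\<lambda>_. borel)) ?X"
      by (rule distr_cong) (auto simp: sets_noise)
    also have "\<dots> = Pi\<^sub>M J (\<lambda>i. distr M borel (waiting_time T i))"
      using indep_vars_iff_distr_eq_PiM[where I = J and M' = "\<lambda>_. borel" and X = "waiting_time T"] mX
        indep_vars_subset[OF ind(1), where J = J] by (auto simp: J_def)
    also have "(\<lambda>i. distr M borel (waiting_time T i)) = (\<lambda>i. expo)"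
    proof
      fix i
      have "distr M borel (waiting_time T i) = distr M lborel (waiting_time T i)"
        by (rule distr_cong) auto
      also have "\<dots> = expo" using dist[of i] by (simp add: distributed_def)
      finally show "distr M borel (waiting_time T i) = expo" .
    qed
    finally show ?thesis unfolding J_def .
  qed
  have lawY: "distr M (marks (Suc k)) ?Y = marks (Suc k)"
  proof -
    have "distr M (marks (Suc k)) ?Y = distr M (Pi\<^sub>M J (\<lambda>_. count_space UNIV)) ?Y"
      by (rule distr_cong) (auto simp: sets_marks)
    also have "\<dots> = Pi\<^sub>M J (\<lambda>i. distr M (count_space UNIV) (e i))"
      using indep_vars_iff_distr_eq_PiM[where I = J and M' = "\<lambda>_. count_space UNIV" and X = e] mY
        indep_vars_subset[OF ind(2), where J = J] by (auto simp: J_def)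
    finally show ?thesis by (simp only: J_def dist_e)
  qed
  \<comment> \<open>Finite restrictions are measurable for the sigma-algebra generated by the whole
    sequence, so their events are covered by the assumed independence.\<close>
  have X_VX: "?X -` A \<inter> space M \<in> sets ?VX" if "A \<in> sets (noise (Suc k))" for A
  proof -
    have "?X' \<in> ?VX \<rightarrow>\<^sub>M Pi\<^sub>M UNIV (\<lambda>_. borel)"
      by (rule measurable_vimage_algebra1) (auto simp: space_PiM)
    moreover have "(\<lambda>f. restrict f J) \<in> Pi\<^sub>M UNIV (\<lambda>_. borel) \<rightarrow>\<^sub>M Pi\<^sub>M J (\<lambda>_. borel :: real measure)"
      by (rule measurable_restrict_subset) simp
    ultimately have "?X \<in> ?VX \<rightarrow>\<^sub>M Pi\<^sub>M J (\<lambda>_. borel)" by (rule measurable_compose)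
    from measurable_sets[OF this] that show ?thesis by (simp add: sets_noise)
  qed
  have Y_VY: "?Y -` A \<inter> space M \<in> sets ?VY" if "A \<in> sets (marks (Suc k))" for A
  proof -
    have "?Y' \<in> ?VY \<rightarrow>\<^sub>M Pi\<^sub>M UNIV (\<lambda>_. count_space UNIV)"
      by (rule measurable_vimage_algebra1) (auto simp: space_PiM)
    moreover have "(\<lambda>f. restrict f J) \<in> Pi\<^sub>M UNIV (\<lambda>_. count_space UNIV) \<rightarrow>\<^sub>M Pi\<^sub>M J (\<lambda>_. count_space (UNIV :: 'v set set))"
      by (rule measurable_restrict_subset) simp
    ultimately have "?Y \<in> ?VY \<rightarrow>\<^sub>M Pi\<^sub>M J (\<lambda>_. count_space UNIV)" by (rule measurable_compose)
    from measurable_sets[OF this] that show ?thesis by (simp add: sets_marks)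
  qed
  have "noise (Suc k) \<Otimes>\<^sub>M marks (Suc k) = distr M (noise (Suc k) \<Otimes>\<^sub>M marks (Suc k)) ?XY"
  proof (rule pair_measure_eqI)
    fix A B assume A: "A \<in> sets (noise (Suc k))" and B: "B \<in> sets (marks (Suc k))"
    have "emeasure (noise (Suc k)) A = prob (?X -` A \<inter> space M)"
      by (subst lawX[symmetric]) (simp add: emeasure_distr[OF mXn A] emeasure_eq_measure)
    moreover have "emeasure (marks (Suc k)) B = prob (?Y -` B \<inter> space M)"
      by (subst lawY[symmetric]) (simp add: emeasure_distr[OF mYn B] emeasure_eq_measure)
    moreover have "emeasure (distr M (noise (Suc k) \<Otimes>\<^sub>M marks (Suc k)) ?XY) (A \<times> B)
        = prob ((?X -` A \<inter> space M) \<inter> (?Y -` B \<inter> space M))"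
      using A B by (subst emeasure_distr[OF XY])
        (auto simp: emeasure_eq_measure intro!: arg_cong[where f = prob])
    ultimately show "emeasure (noise (Suc k)) A * emeasure (marks (Suc k)) B
        = emeasure (distr M (noise (Suc k) \<Otimes>\<^sub>M marks (Suc k)) ?XY) (A \<times> B)"
      using indep_setD[OF ind2 X_VX[OF A] Y_VY[OF B]] by (simp add: ennreal_mult)
  qed (auto simp: prob_space_imp_sigma_finite prob_space_noise prob_space_marks simp del: lessThan_Suc)
  then show "distr M (noise (Suc k) \<Otimes>\<^sub>M marks (Suc k)) ?XY = noise (Suc k) \<Otimes>\<^sub>M marks (Suc k)" by simp
qed

end

section \<open>The expected Lyapunov function\<close>

context gossip_graph
begin

text \<open>Restricting the sequences to their first \<open>k + 1\<close> entries does not change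
  \<open>sojourn\<close>, so the expectation can be computed on the product space.\<close>

lemma nn_integral_sojourn:
  fixes k :: nat
  assumes "prob_space M" "poisson_edge_activations M P T e"
  shows "(\<integral>\<^sup>+ \<omega>. ennreal (sojourn y t k (\<lambda>i. waiting_time T i \<omega>) (\<lambda>i. e i \<omega>)) \<partial>M)
    = (\<integral>\<^sup>+ \<omega>. ennreal (sojourn y t k (fst \<omega>) (snd \<omega>)) \<partial>(noise (Suc k) \<Otimes>\<^sub>M marks (Suc k)))"
proof -
  let ?N = "noise (Suc k) \<Otimes>\<^sub>M marks (Suc k)"
  let ?XY = "\<lambda>\<omega>. (\<lambda>i\<in>{..<Suc k}. waiting_time T i \<omega>, \<lambda>i\<in>{..<Suc k}. e i \<omega>)"
  have m: "(\<lambda>\<omega>. ennreal (sojourn y t k (fst \<omega>) (snd \<omega>))) \<in> borel_measurable ?N"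
    by (intro measurable_ennreal[THEN measurable_compose[rotated]] measurable_sojourn
        component_noise component_marks) auto
  have "(\<integral>\<^sup>+ \<omega>. ennreal (sojourn y t k (fst \<omega>) (snd \<omega>)) \<partial>?N)
      = (\<integral>\<^sup>+ \<omega>. ennreal (sojourn y t k (fst \<omega>) (snd \<omega>)) \<partial>distr M ?N ?XY)"
    by (subst activation_law(2)[OF assms]) simp
  also have "\<dots> = (\<integral>\<^sup>+ \<omega>. ennreal (sojourn y t k (fst (?XY \<omega>)) (snd (?XY \<omega>))) \<partial>M)"
    by (rule nn_integral_distr[OF activation_law(1)[OF assms]]) (use m in simp)
  also have "\<dots> = (\<integral>\<^sup>+ \<omega>. ennreal (sojourn y t k (\<lambda>i. waiting_time T i \<omega>) (\<lambda>i. e i \<omega>)) \<partial>M)"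
    by (intro nn_integral_cong arg_cong[where f = ennreal] sojourn_cong) auto
  finally show ?thesis by simp
qed

text \<open>Sum and integral are exchanged by monotone convergence; the partial sums are bounded
  after discarding the nonnegative weight.\<close>

lemma expected_total_sojourn_le:
  assumes "prob_space M" "poisson_edge_activations M P T e" "t \<ge> 0"
  shows "(\<integral>\<^sup>+ \<omega>. (\<Sum>k. ennreal (sojourn y t k (\<lambda>i. waiting_time T i \<omega>) (\<lambda>i. e i \<omega>))) \<partial>M)
    \<le> ennreal (lyap (y, y))"
proof -
  have mX: "waiting_time T i \<in> borel_measurable M" for i
    using assms(2) distributed_measurable[of M lborel "waiting_time T i"]
    by (auto simp: poisson_edge_activations_def)
  have "prob_space.indep_vars M (\<lambda>_. count_space UNIV) e UNIV"
    using assms(2) by (simp add: poisson_edge_activations_def)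
  then have mY: "e i \<in> M \<rightarrow>\<^sub>M count_space UNIV" for i
    unfolding prob_space.indep_vars_def[OF assms(1)] by simp
  have "(\<lambda>\<omega>. ennreal (sojourn y t k (\<lambda>i. waiting_time T i \<omega>) (\<lambda>i. e i \<omega>))) \<in> borel_measurable M" for k
    by (intro measurable_ennreal[THEN measurable_compose[rotated]] measurable_sojourn mX mY)
  then have "(\<integral>\<^sup>+ \<omega>. (\<Sum>k. ennreal (sojourn y t k (\<lambda>i. waiting_time T i \<omega>) (\<lambda>i. e i \<omega>))) \<partial>M)
      = (\<Sum>k. \<integral>\<^sup>+ \<omega>. ennreal (sojourn y t k (\<lambda>i. waiting_time T i \<omega>) (\<lambda>i. e i \<omega>)) \<partial>M)"
    by (rule nn_integral_suminf)
  also have "\<dots> = (\<Sum>k. \<integral>\<^sup>+ \<omega>. ennreal (sojourn y t k (fst \<omega>) (snd \<omega>)) \<partial>(noise (Suc k) \<Otimes>\<^sub>M marks (Suc k)))"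
    by (simp only: nn_integral_sojourn[OF assms(1,2)])
  also have "\<dots> \<le> ennreal (lyap (y, y))"
  proof (rule suminf_le_const[OF summableI])
    fix n
    show "(\<Sum>k<n. \<integral>\<^sup>+ \<omega>. ennreal (sojourn y t k (fst \<omega>) (snd \<omega>)) \<partial>(noise (Suc k) \<Otimes>\<^sub>M marks (Suc k)))
        \<le> ennreal (lyap (y, y))"
      by (rule order_trans[OF add_increasing2 sum_sojourn_le[OF assms(3), of y n]]) auto
  qed
  finally show ?thesis .
qed

lemma path_deviation_le_sojourn:
  assumes path: "accelerated_gossip_path gap Rmax T b x z" and "x 0 = y" "z 0 = y"
    and a: "\<And>i. a i > 0" and T: "\<And>k. T k = clock (Suc k) a" and b: "\<And>k. b k \<in> E"
    and m: "1 \<bullet> y = real CARD('v) * m" and "0 \<le> t" and escape: "t < clock (Suc n) a"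
  shows "ennreal (exp (rate * t) * (1/2 * (\<Sum>v\<in>UNIV. (x t $ v - m)\<^sup>2)))
    \<le> (\<Sum>k. ennreal (sojourn y t k a b))"
proof -
  \<comment> \<open>By minimality the clock has not passed \<open>t\<close> after \<open>k\<close>
    steps; for \<open>k = 0\<close> this is \<open>0 \<le> t\<close>.\<close>
  define k where "k = (LEAST k. t < clock (Suc k) a)"
  have up: "t < clock (Suc k) a" unfolding k_def using escape by (rule LeastI)
  have low: "clock k a \<le> t"
  proof (cases k)
    case (Suc j)
    then show ?thesis using not_less_Least[of j "\<lambda>k. t < clock (Suc k) a"] unfolding k_def by simp
  qed (use \<open>0 \<le> t\<close> in simp)
  let ?\<xi> = "flow (t - clock k a) (state y k a b)"
  have "(x t, z t) = ?\<xi>"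
    using path_eq_state[OF path assms(2,3) a T b low up] .
  then have x: "x t = fst ?\<xi>" by (metis fst_conv)
  have "1 \<bullet> x t = 1 \<bullet> y"
    unfolding x using one_inner_state[OF b] by (intro one_inner_flow) auto
  then have "1/2 * (\<Sum>v\<in>UNIV. (x t $ v - m)\<^sup>2) \<le> lyap ?\<xi>"
    using half_centre_le_lyap[of ?\<xi>] m by (simp add: sum_square_deviation x)
  then have "exp (rate * t) * (1/2 * (\<Sum>v\<in>UNIV. (x t $ v - m)\<^sup>2)) \<le> sojourn y t k a b"
    using low up by (simp add: sojourn_def)
  then have "ennreal (exp (rate * t) * (1/2 * (\<Sum>v\<in>UNIV. (x t $ v - m)\<^sup>2))) \<le> ennreal (sojourn y t k a b)"
    by (rule ennreal_leI)
  also have "\<dots> \<le> (\<Sum>k. ennreal (sojourn y t k a b))"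
    using sum_le_suminf[OF summableI, of "{k}" "\<lambda>k. ennreal (sojourn y t k a b)"] by simp
  finally show ?thesis .
qed

end

theorem theorem5:
  fixes E :: "'v::finite set set"
    and P :: "'v set pmf"
    and M :: "'o measure"
    and T :: "nat \<Rightarrow> 'o \<Rightarrow> real"
    and e :: "nat \<Rightarrow> 'o \<Rightarrow> 'v set"
    and x z :: "real \<Rightarrow> 'o \<Rightarrow> real^'v"
    and x0 :: "real^'v"
    and xbar :: real
    and t :: real
  assumes "connected_simple_graph E"
    and "CARD('v) \<ge> 2"
    and "set_pmf P = E"
    and "xbar = (\<Sum>v\<in>UNIV. x0 $ v) / real CARD('v)"
    and "prob_space M"
    and "poisson_edge_activations M P T e"
    and "\<And>s. s \<ge> 0 \<Longrightarrow> x s \<in> borel_measurable M"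
    and "\<And>s. s \<ge> 0 \<Longrightarrow> z s \<in> borel_measurable M"
    and "AE \<omega> in M. x 0 \<omega> = x0 \<and> z 0 \<omega> = x0 \<and>
           accelerated_gossip_path (gossip_gap E P) (max_resistance E P)
             (\<lambda>k. T k \<omega>) (\<lambda>k. e k \<omega>) (\<lambda>s. x s \<omega>) (\<lambda>s. z s \<omega>)"
    and "t \<ge> 0"
  shows "(\<forall>v. integrable M (\<lambda>\<omega>. (x t \<omega> $ v - xbar)\<^sup>2)) \<and>
    (\<Sum>v\<in>UNIV. 1/2 * (LINT \<omega>|M. (x t \<omega> $ v - xbar)\<^sup>2))
      \<le> 2 * (\<Sum>v\<in>UNIV. 1/2 * (x0 $ v - xbar)\<^sup>2)
          * exp (- sqrt (gossip_gap E P / (2 * max_resistance E P)) * t)"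
proof -
  interpret gossip_graph E P using assms(1-3) by unfold_locales
  interpret prob_space M by fact
  note poisson = assms(6)[unfolded poisson_edge_activations_def]
  have dist: "distributed M lborel (waiting_time T k) (exponential_density 1)"
    and dist_e: "distr M (count_space UNIV) (e k) = measure_pmf P" for k
    using poisson by auto
  have mean: "1 \<bullet> x0 = real CARD('v) * xbar"
    by (simp add: assms(4) inner_one_vec)
  have "AE \<omega> in M. 0 < waiting_time T k \<omega>" for k
  proof -
    \<comment> \<open>The exponential density does not vanish at 0, so strict positivity also uses
      that a point is a null set.\<close>
    have "AE s in lborel. s \<noteq> (0::real)" by (rule AE_lborel_singleton)
    then have "AE s in expo. 0 < s"
      by (subst AE_density) (auto simp: exponential_density_def elim!: eventually_mono)
    moreover have "distr M lborel (waiting_time T k) = expo"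
      using dist[of k] by (simp add: distributed_def)
    ultimately have "AE s in distr M lborel (waiting_time T k). 0 < s" by (simp only:)
    then show ?thesis
      using distributed_measurable[OF dist[of k]] by (subst (asm) AE_distr_iff) auto
  qed
  then have pos: "AE \<omega> in M. \<forall>k. 0 < waiting_time T k \<omega>" by (simp add: AE_all_countable)
  have "AE \<omega> in M. e k \<omega> \<in> E" for k
  proof -
    have "e k \<in> M \<rightarrow>\<^sub>M count_space UNIV" using poisson by (auto simp: indep_vars_def)
    moreover have "AE s in distr M (count_space UNIV) (e k). s \<in> E"
      unfolding dist_e support[symmetric] by (rule AE_measure_pmf)
    ultimately show ?thesis by (subst (asm) AE_distr_iff) auto
  qed
  then have edges: "AE \<omega> in M. \<forall>k. e k \<omega> \<in> E" by (simp add: AE_all_countable)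
  have escape: "AE \<omega> in M. \<exists>k. t < clock (Suc k) (\<lambda>i. waiting_time T i \<omega>)"
    using nonexplosion[OF assms(5) dist _ assms(10)] poisson by simp
  define D where "D \<omega> = (\<Sum>v\<in>UNIV. (x t \<omega> $ v - xbar)\<^sup>2)" for \<omega>
  define C where "C = centre x0 \<bullet> centre x0"
  have comp [measurable]: "(\<lambda>\<omega>. (x t \<omega> $ v - xbar)\<^sup>2) \<in> borel_measurable M" for v
  proof -
    have "(\<lambda>\<omega>. x t \<omega> $ v) \<in> borel_measurable M"
      by (rule borel_measurable_continuous_on[OF _ assms(7)[OF assms(10)]]) (intro continuous_intros)
    then show ?thesis by measurable
  qed
  have D_meas [measurable]: "D \<in> borel_measurable M" unfolding D_def by measurable
  have D_nonneg: "D \<omega> \<ge> 0" for \<omega> by (simp add: D_def sum_nonneg)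
  have "(\<integral>\<^sup>+ \<omega>. ennreal (exp (rate * t) * (1/2 * D \<omega>)) \<partial>M)
      \<le> (\<integral>\<^sup>+ \<omega>. (\<Sum>k. ennreal (sojourn x0 t k (\<lambda>i. waiting_time T i \<omega>) (\<lambda>i. e i \<omega>))) \<partial>M)"
  proof (rule nn_integral_mono_AE)
    show "AE \<omega> in M. ennreal (exp (rate * t) * (1/2 * D \<omega>))
        \<le> (\<Sum>k. ennreal (sojourn x0 t k (\<lambda>i. waiting_time T i \<omega>) (\<lambda>i. e i \<omega>)))"
      using assms(9) pos edges escape
    proof eventually_elim
      case (elim \<omega>)
      then obtain n where "t < clock (Suc n) (\<lambda>i. waiting_time T i \<omega>)" by blast
      then show ?case
        unfolding D_def using elim mean assms(10) clock_waiting_time[of _ T \<omega>]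
        by (intro path_deviation_le_sojourn[where T = "\<lambda>k. T k \<omega>" and z = "\<lambda>s. z s \<omega>"
              and x = "\<lambda>s. x s \<omega>"]) auto
    qed
  qed
  also have "\<dots> \<le> ennreal (lyap (x0, x0))"
    by (rule expected_total_sojourn_le) fact+
  also have "\<dots> \<le> ennreal C" unfolding C_def by (intro ennreal_leI lyap_diagonal_le)
  finally have bound: "(\<integral>\<^sup>+ \<omega>. ennreal (exp (rate * t) * (1/2 * D \<omega>)) \<partial>M) \<le> ennreal C" .
  have "integrable M (\<lambda>\<omega>. exp (rate * t) * (1/2 * D \<omega>))"
  proof (rule integrableI_bounded)
    have "(\<integral>\<^sup>+ \<omega>. ennreal (norm (exp (rate * t) * (1/2 * D \<omega>))) \<partial>M) \<le> ennreal C"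
      using bound D_nonneg by simp
    then show "(\<integral>\<^sup>+ \<omega>. ennreal (norm (exp (rate * t) * (1/2 * D \<omega>))) \<partial>M) < \<infinity>"
      by (rule order.strict_trans1) simp
  qed measurable
  then have "integrable M (\<lambda>\<omega>. 2 / exp (rate * t) * (exp (rate * t) * (1/2 * D \<omega>)))"
    by (rule integrable_mult_right)
  then have D_int: "integrable M D" by simp
  \<comment> \<open>A Bochner integral is 0 by convention when the function is not integrable, so
    integrability is proved as well, by domination by the total deviation \<open>D\<close>.\<close>
  have int: "integrable M (\<lambda>\<omega>. (x t \<omega> $ v - xbar)\<^sup>2)" for v
  proof (rule Bochner_Integration.integrable_bound[OF D_int comp])
    have "(x t \<omega> $ v - xbar)\<^sup>2 \<le> D \<omega>" for \<omega>
      unfolding D_def by (rule member_le_sum) auto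
    then show "AE \<omega> in M. norm ((x t \<omega> $ v - xbar)\<^sup>2) \<le> norm (D \<omega>)"
      using D_nonneg by simp
  qed
  have "ennreal (LINT \<omega>|M. exp (rate * t) * (1/2 * D \<omega>)) \<le> ennreal C"
    using bound D_int D_nonneg by (subst nn_integral_eq_integral[symmetric]) auto
  then have "exp (rate * t) * (1/2 * (LINT \<omega>|M. D \<omega>)) \<le> C"
    by (simp add: C_def)
  then have "exp (- rate * t) * (exp (rate * t) * (1/2 * (LINT \<omega>|M. D \<omega>))) \<le> exp (- rate * t) * C"
    by (rule mult_left_mono) simp
  moreover have "exp (- rate * t) * (exp (rate * t) * u) = u" for u :: real
    by (simp flip: mult.assoc exp_add)
  ultimately have "1/2 * (LINT \<omega>|M. D \<omega>) \<le> C * exp (- rate * t)"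
    by (simp only: mult.commute[of C])
  moreover have "1/2 * (LINT \<omega>|M. D \<omega>) = (\<Sum>v\<in>UNIV. 1/2 * (LINT \<omega>|M. (x t \<omega> $ v - xbar)\<^sup>2))"
    unfolding D_def using int by (simp add: sum_distrib_left)
  moreover have "C = 2 * (\<Sum>v\<in>UNIV. 1/2 * (x0 $ v - xbar)\<^sup>2)"
    unfolding C_def sum_square_deviation[OF mean, symmetric] by (simp add: sum_distrib_left)
  ultimately show ?thesis using int by (simp add: rate_def)
qed

end
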